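(* Let $\mathbf F:\mathbf X\to\mathbf Y$ be an omega pseudo-functor. Suppose that $\mathbf F$ is a weak equivalence and that $\mathbf X,\mathbf Y$ are $1$-skeletal. Then $F_1$ is an equivalence of ordinary categories.
   Context: A globular set $X$ is a sequence of sets $X_i$ ($i\ge 0$; elements are called $i$-cells) with functions $dom_{i-1}^i,cod_{i-1}^i:X_i\to X_{i-1}$ ($i>0$) satisfying $dom_{i-1}^i dom_i^{i+1}=dom_{i-1}^i cod_i^{i+1}$ and $cod_{i-1}^i dom_i^{i+1}=cod_{i-1}^i cod_i^{i+1}$. For $i<j$, $dom_i^j,cod_i^j:X_j\to X_i$ are the iterated composites. An omega graph is a globular set with functions $id_i^{i-1}:X_{i-1}\to X_i$ ($i>0$) with $dom_{i-1}^i id_i^{i-1}x=x=cod_{i-1}^i id_i^{i-1}x$; $id_j^i$ denotes the iterated composite $X_i\to X_j$. Cells in the image of $id_i^{i-1}$ are identity cells; an omega graph is $n$-skeletal if every cell of dimension $>n$ is an identity cell. An omega magma is an omega graph with, for all $0\le i<j$, a partial binary operation $a\circ_i^j b$ on $j$-cells, defined exactly when $cod_i^j a=dom_i^j b$, such that: if $i+1=j$, then $dom_i^j(a\circ_i^j b)=dom_i^j a$ and $cod_i^j(a\circ_i^j b)=cod_i^j b$; if $i+1<j$, then $dom_{j-1}^j(a\circ_i^j b)=dom_{j-1}^ja\circ_i^{j-1}dom_{j-1}^jb$ and likewise for $cod_{j-1}^j$. Morphisms of globular sets, omega graphs and omega magmas preserve all the respective structure. A strict omega category is an omega magma in which (whenever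 the composites are defined) $(a\circ_i^jb)\circ_i^jc=a\circ_i^j(b\circ_i^jc)$; $(a\circ_j^kb)\circ_i^k(c\circ_j^kd)=(a\circ_i^kc)\circ_j^k(b\circ_i^kd)$ for $i<j<k$; $a=id_j^i(dom_i^ja)\circ_i^ja=a\circ_i^jid_j^i(cod_i^ja)$; and $id_{j+1}^j(a)\circ_i^{j+1}id_{j+1}^j(b)=id_{j+1}^j(a\circ_i^jb)$ for $i<j$. Two $i$-cells $a,b$ are parallel, $a\parallel b$, if they have the same $dom_{i-1}^i$ and the same $cod_{i-1}^i$; any two $0$-cells are parallel. A bridge relation $R$ on an omega graph (or omega magma) $X$ is a sequence $R_i\subseteq X_i\times X_i\times X_{i+1}$ ($i\ge0$) such that: $(a,b,c)\in R_i$ implies $a\parallel b$, $dom_i^{i+1}c=a$, $cod_i^{i+1}c=b$; $(a,a,id_{i+1}^ia)\in R_i$ for all $a\in X_i$; $(a,b,c),(a,b,d)\in R_i$ implies $c=d$. The diagonal bridge relation $R^\Delta$ consists of all triples $(a,a,id_{i+1}^ia)$. A bridge morphism $F:(X,R^X)\to(Y,R^Y)$ is an omega magma morphism with $(a,b,c)\in R_i^X\Rightarrow(Fa,Fb,Fc)\in R_i^Y$. A categorical Penon morphism is a bridge morphism $F:(X,R^X)\to(Y,R^Y)$ such that $Y$ is a strict omega category, $R^Y=R^\Delta$; $(a,b,c)\in R_i^X$ implies $Fa=Fb$ and $Fc=id_{i+1}^i(Fa)$; and if $a,b\in X_i$, $a\parallel b$, $Fa=Fb$, then there is $c$ with $(a,b,c)\in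 R_i^X$. A weak omega category $\mathbf X$ consists of omega magmas $X_1$ (the underlying magma) and $X_2$, an omega magma morphism $\lambda^X:X_2\to X_1$, a morphism $\rho^X:X_1\to X_2$ of omega graphs with $\lambda^X\circ\rho^X=1$ (as omega graph morphisms), a bridge relation $R^X$ on $X_2$, a strict omega category $X_3$, and a categorical Penon morphism $\kappa^X:(X_2,R^X)\to(X_3,R^\Delta)$. It is $n$-skeletal if $X_1$ is $n$-skeletal. If $\mathbf X$ is $1$-skeletal, $X_1$ is an ordinary category: objects are $0$-cells, morphisms are $1$-cells, composition is $\circ_0^1$ and identities are given by $id_1^0$. An omega pseudo-functor $\mathbf F:\mathbf X\to\mathbf Y$ is a triple of morphisms of globular sets $F_i:X_i\to Y_i$ ($i=1,2,3$) such that $F_3$ is a morphism of omega graphs; $F_1\lambda^X=\lambda^YF_2$ and $F_3\kappa^X=\kappa^YF_2$ as morphisms of globular sets; and $\kappa^Y(F_2a\circ_{j-1}^jF_2b)=\kappa^YF_2(a\circ_{j-1}^jb)$ whenever $a\circ_{j-1}^jb$ is defined in $X_2$. Internal equivalences. An omega clique is an omega magma $M$ with a bridge relation $R^M$ such that for every parallel pair $a,b\in M_j$ there is $c$ with $(a,b,c)\in R_j^M$. Let $K(2)$ be the omega graph with exactly two $0$-cells $1,2$ and all other cells identities on these. $Cl(2)$ is the omega clique freely generated by $K(2)$: it comes with an omega graph morphism $K(2)\to Cl(2)$, and every omega graph morphism from $K(2)$ to an omega clique extends uniquely to a bridge morphism from $Cl(2)$. For $i,j\in\{1,2\}$ let $c(i,j)$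 be the unique bridge $1$-cell from the $0$-cell $i$ to the $0$-cell $j$ given by the bridge relation of $Cl(2)$. For an omega magma $M$ and $(i-1)$-cells $a,b$, $M(a,b)$ is the omega magma with $M(a,b)_j=\{c\in M_{i+j}: dom_{i-1}^{i+j}c=a,\ cod_{i-1}^{i+j}c=b\}$ and structure that of $M$ restricted and reindexed. A $1$-cell $f$ of $M$ is an elementary internal equivalence if it is an identity cell or there is an omega magma morphism $H:Cl(2)\to M$ with $H(c(1,2))=f$; for $i\ge2$ an $i$-cell $f$ is one if it is an identity cell or there is an omega magma morphism $H:Cl(2)\to M(dom_{i-2}^if,cod_{i-2}^if)$ with $H(c(1,2))=f$. $el(M)$ is the graded subset of these ($el(M)_0=\emptyset$). For a graded subset $S\subseteq M$, $\overline S$ is the smallest graded subset containing all (iterated) composites of elements of $S$, including the elements of $S$; and $T(S)$ is the smallest graded subset containing, for every $k\ge1$, every $f\in M_k$ for which there are $g\in M_k$ with $dom_{k-1}^kg=cod_{k-1}^kf$, $cod_{k-1}^kg=dom_{k-1}^kf$, and $h,h'\in S$ with $dom_k^{k+1}h=f\circ_{k-1}^kg$, $cod_k^{k+1}h=id_k^{k-1}dom_{k-1}^kf$, $dom_k^{k+1}h'=g\circ_{k-1}^kf$, $cod_k^{k+1}h'=id_k^{k-1}cod_{k-1}^kf$. Put $S_1(M)=\overline{el(M)}$, $S_i(M)=\overline{S_{i-1}(M)\cup T(S_{i-1}(M))}$ for $i\ge2$, and $Eq(M)=\bigcup_{i\ge1}S_i(M)$, the graded subset of internal equivalences. Weak equivalences.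 An omega pseudo-functor $\mathbf F:\mathbf X\to\mathbf Y$ is tame if $F_1(Eq(X_1))\subseteq Eq(Y_1)$. For an omega magma $M$, let $\Pi M$ be the set of classes of $0$-cells of $M$ under the relation $a\approx b$ iff there is $f\in Eq(M)_1$ with $dom_0^1f=a$, $cod_0^1f=b$; put $\Pi\mathbf X=\Pi X_1$. For $(i-1)$-cells $a,b$ of $X_1$ the hom weak omega category $\mathbf X(a,b)$ has underlying omega magma $X_1(a,b)$, so $\Pi\mathbf X(a,b)=\Pi(X_1(a,b))$, and $\mathbf F$ restricts to $\mathbf F(a,b):\mathbf X(a,b)\to\mathbf Y(F_1a,F_1b)$ with first component the restriction of $F_1$. The maps $\Pi\mathbf F:\Pi\mathbf X\to\Pi\mathbf Y$ and $\Pi\mathbf F(a,b):\Pi\mathbf X(a,b)\to\Pi\mathbf Y(F_1a,F_1b)$ are induced by $F_1$. A tame omega pseudo-functor $\mathbf F$ is a weak equivalence if $\Pi\mathbf F$ and $\Pi\mathbf F(a,b)$ are isomorphisms (bijections) for all $(i-1)$-cells $a,b$ of $X_1$ and all $i\ge1$. *)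

theory Defs
  imports Main
begin

section \<open>Globular sets, omega graphs, omega magmas, strict omega categories\<close>

text \<open>
  All cells of a structure live in one type, and \<open>Cell X i\<close> is the set of \<open>i\<close>-cells.  The sets
  for different \<open>i\<close> need not be disjoint, so operations and morphisms take the dimension as
  an argument.  \<open>Dom X i\<close> and \<open>Cod X i\<close> go from \<open>(i+1)\<close>-cells to \<open>i\<close>-cells, and \<open>Idn X i\<close> from
  \<open>i\<close>-cells to \<open>(i+1)\<close>-cells.  \<open>Comp X i j a b\<close> is the composite of the \<open>j\<close>-cells \<open>a\<close>, \<open>b\<close> along
  their common \<open>i\<close>-cell; composition is diagrammatic (the codomain of \<open>a\<close> is the domain of
  \<open>b\<close>), and the value of \<open>Comp\<close> has no meaning unless \<open>composable X i j a b\<close> holds.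
\<close>

record 'a globular_set =
  Cell :: "nat \<Rightarrow> 'a set"
  Dom :: "nat \<Rightarrow> 'a \<Rightarrow> 'a"
  Cod :: "nat \<Rightarrow> 'a \<Rightarrow> 'a"

record 'a omega_graph = "'a globular_set" +
  Idn :: "nat \<Rightarrow> 'a \<Rightarrow> 'a"

record 'a omega_magma = "'a omega_graph" +
  Comp :: "nat \<Rightarrow> nat \<Rightarrow> 'a \<Rightarrow> 'a \<Rightarrow> 'a"

text \<open>The iterated maps from \<open>j\<close>-cells to \<open>i\<close>-cells (resp. from \<open>i\<close>-cells to \<open>j\<close>-cells), for
  \<open>i \<le> j\<close>.\<close>

primrec iter_dom :: "('a, 'm) globular_set_scheme \<Rightarrow> nat \<Rightarrow> nat \<Rightarrow> 'a \<Rightarrow> 'a" where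
  "iter_dom X i 0 x = x"
| "iter_dom X i (Suc j) x = (if i \<le> j then iter_dom X i j (Dom X j x) else x)"

primrec iter_cod :: "('a, 'm) globular_set_scheme \<Rightarrow> nat \<Rightarrow> nat \<Rightarrow> 'a \<Rightarrow> 'a" where
  "iter_cod X i 0 x = x"
| "iter_cod X i (Suc j) x = (if i \<le> j then iter_cod X i j (Cod X j x) else x)"

primrec iter_id :: "('a, 'm) omega_graph_scheme \<Rightarrow> nat \<Rightarrow> nat \<Rightarrow> 'a \<Rightarrow> 'a" where
  "iter_id X i 0 x = x"
| "iter_id X i (Suc j) x = (if i \<le> j then Idn X j (iter_id X i j x) else x)"

definition composable :: "('a, 'm) globular_set_scheme \<Rightarrow> nat \<Rightarrow> nat \<Rightarrow> 'a \<Rightarrow> 'a \<Rightarrow> bool" where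
  "composable X i j a b \<longleftrightarrow>
     i < j \<and> a \<in> Cell X j \<and> b \<in> Cell X j \<and> iter_cod X i j a = iter_dom X i j b"

fun parallel :: "('a, 'm) globular_set_scheme \<Rightarrow> nat \<Rightarrow> 'a \<Rightarrow> 'a \<Rightarrow> bool" where
  "parallel X 0 a b \<longleftrightarrow> True"
| "parallel X (Suc i) a b \<longleftrightarrow> Dom X i a = Dom X i b \<and> Cod X i a = Cod X i b"

locale globular_set =
  fixes X :: "('a, 'm) globular_set_scheme"
  assumes dom_cell: "x \<in> Cell X (Suc i) \<Longrightarrow> Dom X i x \<in> Cell X i"
    and cod_cell: "x \<in> Cell X (Suc i) \<Longrightarrow> Cod X i x \<in> Cell X i"
    and dom_dom: "x \<in> Cell X (Suc (Suc i)) \<Longrightarrow>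
      Dom X i (Dom X (Suc i) x) = Dom X i (Cod X (Suc i) x)"
    and cod_dom: "x \<in> Cell X (Suc (Suc i)) \<Longrightarrow>
      Cod X i (Dom X (Suc i) x) = Cod X i (Cod X (Suc i) x)"

locale omega_graph = globular_set X for X :: "('a, 'm) omega_graph_scheme" +
  assumes id_cell: "x \<in> Cell X i \<Longrightarrow> Idn X i x \<in> Cell X (Suc i)"
    and dom_id: "x \<in> Cell X i \<Longrightarrow> Dom X i (Idn X i x) = x"
    and cod_id: "x \<in> Cell X i \<Longrightarrow> Cod X i (Idn X i x) = x"

definition skeletal :: "nat \<Rightarrow> ('a, 'm) omega_graph_scheme \<Rightarrow> bool" where
  "skeletal n X \<longleftrightarrow> (\<forall>k\<ge>n. Cell X (Suc k) \<subseteq> Idn X k ` Cell X k)"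

locale omega_magma = omega_graph X for X :: "('a, 'm) omega_magma_scheme" +
  assumes comp_cell: "composable X i j a b \<Longrightarrow> Comp X i j a b \<in> Cell X j"
    and dom_comp: "composable X i (Suc i) a b \<Longrightarrow>
      Dom X i (Comp X i (Suc i) a b) = Dom X i a"
    and cod_comp: "composable X i (Suc i) a b \<Longrightarrow>
      Cod X i (Comp X i (Suc i) a b) = Cod X i b"
    and dom_comp_lower: "composable X i (Suc j) a b \<Longrightarrow> i < j \<Longrightarrow>
      Dom X j (Comp X i (Suc j) a b) = Comp X i j (Dom X j a) (Dom X j b)"
    and cod_comp_lower: "composable X i (Suc j) a b \<Longrightarrow> i < j \<Longrightarrow>
      Cod X j (Comp X i (Suc j) a b) = Comp X i j (Cod X j a) (Cod X j b)"

locale strict_omega_category = omega_magma X for X :: "('a, 'm) omega_magma_scheme" +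
  assumes assoc: "composable X i j a b \<Longrightarrow> composable X i j (Comp X i j a b) c \<Longrightarrow>
      composable X i j b c \<Longrightarrow> composable X i j a (Comp X i j b c) \<Longrightarrow>
      Comp X i j (Comp X i j a b) c = Comp X i j a (Comp X i j b c)"
    and interchange: "i < j \<Longrightarrow> j < k \<Longrightarrow>
      composable X j k a b \<Longrightarrow> composable X j k c d \<Longrightarrow>
      composable X i k (Comp X j k a b) (Comp X j k c d) \<Longrightarrow>
      composable X i k a c \<Longrightarrow> composable X i k b d \<Longrightarrow>
      composable X j k (Comp X i k a c) (Comp X i k b d) \<Longrightarrow>
      Comp X i k (Comp X j k a b) (Comp X j k c d)
        = Comp X j k (Comp X i k a c) (Comp X i k b d)"
    and left_unit: "i < j \<Longrightarrow> a \<in> Cell X j \<Longrightarrow>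
      Comp X i j (iter_id X i j (iter_dom X i j a)) a = a"
    and right_unit: "i < j \<Longrightarrow> a \<in> Cell X j \<Longrightarrow>
      Comp X i j a (iter_id X i j (iter_cod X i j a)) = a"
    and id_comp: "composable X i j a b \<Longrightarrow>
      Comp X i (Suc j) (Idn X j a) (Idn X j b) = Idn X j (Comp X i j a b)"

definition globular_morphism ::
    "('a, 'm) globular_set_scheme \<Rightarrow> ('b, 'n) globular_set_scheme \<Rightarrow> (nat \<Rightarrow> 'a \<Rightarrow> 'b) \<Rightarrow> bool" where
  "globular_morphism X Y F \<longleftrightarrow>
     (\<forall>i. \<forall>x\<in>Cell X i. F i x \<in> Cell Y i) \<and>
     (\<forall>i. \<forall>x\<in>Cell X (Suc i). F i (Dom X i x) = Dom Y i (F (Suc i) x)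
        \<and> F i (Cod X i x) = Cod Y i (F (Suc i) x))"

definition graph_morphism ::
    "('a, 'm) omega_graph_scheme \<Rightarrow> ('b, 'n) omega_graph_scheme \<Rightarrow> (nat \<Rightarrow> 'a \<Rightarrow> 'b) \<Rightarrow> bool" where
  "graph_morphism X Y F \<longleftrightarrow> globular_morphism X Y F \<and>
     (\<forall>i. \<forall>x\<in>Cell X i. F (Suc i) (Idn X i x) = Idn Y i (F i x))"

definition magma_morphism ::
    "('a, 'm) omega_magma_scheme \<Rightarrow> ('b, 'n) omega_magma_scheme \<Rightarrow> (nat \<Rightarrow> 'a \<Rightarrow> 'b) \<Rightarrow> bool" where
  "magma_morphism X Y F \<longleftrightarrow> graph_morphism X Y F \<and>
     (\<forall>i j a b. composable X i j a b \<longrightarrow>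
        F j (Comp X i j a b) = Comp Y i j (F j a) (F j b))"


section \<open>Bridge relations and categorical Penon morphisms\<close>

locale bridge_relation = omega_graph X for X :: "('a, 'm) omega_graph_scheme" +
  fixes R :: "nat \<Rightarrow> ('a \<times> 'a \<times> 'a) set"
  assumes bridge_cells: "(a, b, c) \<in> R i \<Longrightarrow>
      a \<in> Cell X i \<and> b \<in> Cell X i \<and> c \<in> Cell X (Suc i)"
    and bridge_boundary: "(a, b, c) \<in> R i \<Longrightarrow>
      parallel X i a b \<and> Dom X i c = a \<and> Cod X i c = b"
    and bridge_refl: "a \<in> Cell X i \<Longrightarrow> (a, a, Idn X i a) \<in> R i"
    and bridge_unique: "(a, b, c) \<in> R i \<Longrightarrow> (a, b, d) \<in> R i \<Longrightarrow> c = d"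

definition diagonal_bridge ::
    "('a, 'm) omega_graph_scheme \<Rightarrow> nat \<Rightarrow> ('a \<times> 'a \<times> 'a) set" where
  "diagonal_bridge X i = {(a, a, Idn X i a) | a. a \<in> Cell X i}"

definition bridge_morphism ::
    "('a, 'm) omega_magma_scheme \<Rightarrow> (nat \<Rightarrow> ('a \<times> 'a \<times> 'a) set) \<Rightarrow>
     ('b, 'n) omega_magma_scheme \<Rightarrow> (nat \<Rightarrow> ('b \<times> 'b \<times> 'b) set) \<Rightarrow>
     (nat \<Rightarrow> 'a \<Rightarrow> 'b) \<Rightarrow> bool" where
  "bridge_morphism X R Y S F \<longleftrightarrow> magma_morphism X Y F \<and>
     (\<forall>i a b c. (a, b, c) \<in> R i \<longrightarrow> (F i a, F i b, F (Suc i) c) \<in> S i)"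

definition categorical_Penon_morphism ::
    "('a, 'm) omega_magma_scheme \<Rightarrow> (nat \<Rightarrow> ('a \<times> 'a \<times> 'a) set) \<Rightarrow>
     ('b, 'n) omega_magma_scheme \<Rightarrow> (nat \<Rightarrow> ('b \<times> 'b \<times> 'b) set) \<Rightarrow>
     (nat \<Rightarrow> 'a \<Rightarrow> 'b) \<Rightarrow> bool" where
  "categorical_Penon_morphism X R Y S F \<longleftrightarrow>
     bridge_morphism X R Y S F \<and> strict_omega_category Y \<and> S = diagonal_bridge Y \<and>
     (\<forall>i a b c. (a, b, c) \<in> R i \<longrightarrow> F i a = F i b \<and> F (Suc i) c = Idn Y i (F i a)) \<and>
     (\<forall>i. \<forall>a\<in>Cell X i. \<forall>b\<in>Cell X i. parallel X i a b \<longrightarrow> F i a = F i b \<longrightarrow>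
        (\<exists>c. (a, b, c) \<in> R i))"


section \<open>Weak omega categories and omega pseudo-functors\<close>

record ('a, 'b, 'c) weak_omega_category =
  mag1 :: "'a omega_magma"
  mag2 :: "'b omega_magma"
  mag3 :: "'c omega_magma"
  lam :: "nat \<Rightarrow> 'b \<Rightarrow> 'a"
  rho :: "nat \<Rightarrow> 'a \<Rightarrow> 'b"
  brel :: "nat \<Rightarrow> ('b \<times> 'b \<times> 'b) set"
  kap :: "nat \<Rightarrow> 'b \<Rightarrow> 'c"

locale weak_omega_category =
  fixes X :: "('a, 'b, 'c) weak_omega_category"
  assumes mag1: "omega_magma (mag1 X)"
    and mag2: "omega_magma (mag2 X)"
    and mag3: "strict_omega_category (mag3 X)"
    and lam: "magma_morphism (mag2 X) (mag1 X) (lam X)"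
    and rho: "graph_morphism (mag1 X) (mag2 X) (rho X)"
    and lam_rho: "x \<in> Cell (mag1 X) i \<Longrightarrow> lam X i (rho X i x) = x"
    and brel: "bridge_relation (mag2 X) (brel X)"
    and kap: "categorical_Penon_morphism (mag2 X) (brel X)
      (mag3 X) (diagonal_bridge (mag3 X)) (kap X)"

definition omega_pseudo_functor ::
    "('a1, 'a2, 'a3) weak_omega_category \<Rightarrow> ('b1, 'b2, 'b3) weak_omega_category \<Rightarrow>
     (nat \<Rightarrow> 'a1 \<Rightarrow> 'b1) \<Rightarrow> (nat \<Rightarrow> 'a2 \<Rightarrow> 'b2) \<Rightarrow> (nat \<Rightarrow> 'a3 \<Rightarrow> 'b3) \<Rightarrow> bool" where
  "omega_pseudo_functor X Y F1 F2 F3 \<longleftrightarrow>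
     globular_morphism (mag1 X) (mag1 Y) F1 \<and>
     globular_morphism (mag2 X) (mag2 Y) F2 \<and>
     graph_morphism (mag3 X) (mag3 Y) F3 \<and>
     (\<forall>i. \<forall>x\<in>Cell (mag2 X) i. F1 i (lam X i x) = lam Y i (F2 i x)) \<and>
     (\<forall>i. \<forall>x\<in>Cell (mag2 X) i. F3 i (kap X i x) = kap Y i (F2 i x)) \<and>
     (\<forall>i a b. composable (mag2 X) i (Suc i) a b \<longrightarrow>
        kap Y (Suc i) (Comp (mag2 Y) i (Suc i) (F2 (Suc i) a) (F2 (Suc i) b))
          = kap Y (Suc i) (F2 (Suc i) (Comp (mag2 X) i (Suc i) a b)))"


section \<open>The free omega clique on two objects\<close>

locale omega_clique = omega_magma M + bridge_relation M R
  for M :: "('a, 'm) omega_magma_scheme" and R +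
  assumes bridge_exists: "a \<in> Cell M j \<Longrightarrow> b \<in> Cell M j \<Longrightarrow> parallel M j a b \<Longrightarrow>
    \<exists>c. (a, b, c) \<in> R j"

definition K2 :: "nat omega_graph" where
  "K2 = \<lparr>Cell = \<lambda>_. {1, 2}, Dom = \<lambda>_ x. x, Cod = \<lambda>_ x. x, Idn = \<lambda>_ x. x\<rparr>"

text \<open>
  \<open>Cl2\<close> is the term model.  An omega magma satisfies no equations between composites beyond
  those for boundaries, so the only identification among formal terms is the one
  forced by bridges being unique and reflexive: the bridge from \<open>a\<close> to \<open>a\<close> is the identity
  on \<open>a\<close>.  It is built in by admitting \<open>BridgeT a b\<close> only for \<open>a \<noteq> b\<close>.  The lemmas
  \<open>Cl2_extension_exists\<close> and \<open>Cl2_extension_unique\<close> below state the universal property.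
\<close>

datatype cl_term = PointT nat | IdT cl_term | BridgeT cl_term cl_term | CompT nat cl_term cl_term

primrec cl_dim :: "cl_term \<Rightarrow> nat" where
  "cl_dim (PointT k) = 0"
| "cl_dim (IdT a) = Suc (cl_dim a)"
| "cl_dim (BridgeT a b) = Suc (cl_dim a)"
| "cl_dim (CompT i a b) = cl_dim a"

primrec cl_dom :: "cl_term \<Rightarrow> cl_term" where
  "cl_dom (PointT k) = PointT k"
| "cl_dom (IdT a) = a"
| "cl_dom (BridgeT a b) = a"
| "cl_dom (CompT i a b) =
     (if cl_dim a = Suc i then cl_dom a else CompT i (cl_dom a) (cl_dom b))"

primrec cl_cod :: "cl_term \<Rightarrow> cl_term" where
  "cl_cod (PointT k) = PointT k"
| "cl_cod (IdT a) = a"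
| "cl_cod (BridgeT a b) = b"
| "cl_cod (CompT i a b) =
     (if cl_dim a = Suc i then cl_cod b else CompT i (cl_cod a) (cl_cod b))"

primrec cl_wf :: "cl_term \<Rightarrow> bool" where
  "cl_wf (PointT k) \<longleftrightarrow> k \<in> {1, 2}"
| "cl_wf (IdT a) \<longleftrightarrow> cl_wf a"
| "cl_wf (BridgeT a b) \<longleftrightarrow> cl_wf a \<and> cl_wf b \<and> cl_dim a = cl_dim b \<and> a \<noteq> b \<and>
     (0 < cl_dim a \<longrightarrow> cl_dom a = cl_dom b \<and> cl_cod a = cl_cod b)"
| "cl_wf (CompT i a b) \<longleftrightarrow> cl_wf a \<and> cl_wf b \<and> cl_dim a = cl_dim b \<and> i < cl_dim a \<and>
     (cl_cod ^^ (cl_dim a - i)) a = (cl_dom ^^ (cl_dim b - i)) b"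

definition Cl2 :: "cl_term omega_magma" where
  "Cl2 = \<lparr>Cell = \<lambda>n. {t. cl_wf t \<and> cl_dim t = n}, Dom = \<lambda>_. cl_dom, Cod = \<lambda>_. cl_cod,
     Idn = \<lambda>_. IdT, Comp = \<lambda>i _ a b. CompT i a b\<rparr>"

definition cl_bridge :: "cl_term \<Rightarrow> cl_term \<Rightarrow> cl_term" where
  "cl_bridge a b = (if a = b then IdT a else BridgeT a b)"

definition Cl2_rel :: "nat \<Rightarrow> (cl_term \<times> cl_term \<times> cl_term) set" where
  "Cl2_rel i = {(a, b, cl_bridge a b) | a b.
     a \<in> Cell Cl2 i \<and> b \<in> Cell Cl2 i \<and> parallel Cl2 i a b}"

definition K2_incl :: "nat \<Rightarrow> nat \<Rightarrow> cl_term" where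
  "K2_incl n k = (IdT ^^ n) (PointT k)"

definition cl_c :: "nat \<Rightarrow> nat \<Rightarrow> cl_term" where
  "cl_c i j = cl_bridge (PointT i) (PointT j)"

lemma Cl2_simps [simp]:
  "t \<in> Cell Cl2 n \<longleftrightarrow> cl_wf t \<and> cl_dim t = n"
  "Dom Cl2 n t = cl_dom t" "Cod Cl2 n t = cl_cod t" "Idn Cl2 n t = IdT t"
  "Comp Cl2 i j t u = CompT i t u"
  by (simp_all add: Cl2_def)

lemma cl_boundary:
  assumes "cl_wf t" and "0 < cl_dim t"
  shows "cl_wf (cl_dom t) \<and> cl_wf (cl_cod t) \<and>
    cl_dim t = Suc (cl_dim (cl_dom t)) \<and> cl_dim t = Suc (cl_dim (cl_cod t)) \<and>
    (Suc 0 < cl_dim t \<longrightarrow> cl_dom (cl_dom t) = cl_dom (cl_cod t) \<and>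
      cl_cod (cl_dom t) = cl_cod (cl_cod t))"
  using assms
proof (induction t)
  case (CompT i a b)
  have wf: "cl_wf a" "cl_wf b" "cl_dim b = cl_dim a" "i < cl_dim a"
    and glue: "(cl_cod ^^ (cl_dim a - i)) a = (cl_dom ^^ (cl_dim a - i)) b"
    using CompT.prems by auto
  have pos: "0 < cl_dim a" "0 < cl_dim b" using wf by auto
  note a = CompT.IH(1)[OF wf(1) pos(1)] and b = CompT.IH(2)[OF wf(2) pos(2)]
  consider "cl_dim a = Suc i" | m where "cl_dim a = Suc (Suc (i + m))"
    using wf(4) by (metis add_Suc_right less_imp_Suc_add not0_implies_Suc add.right_neutral)
  then show ?case
  proof cases
    case 1
    then show ?thesis using a b wf glue by auto
  next
    case (2 m)
    have da: "cl_dim (cl_dom a) = Suc (i + m)" "cl_dim (cl_cod a) = Suc (i + m)"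
      "cl_dim (cl_dom b) = Suc (i + m)" "cl_dim (cl_cod b) = Suc (i + m)"
      using 2 a b wf by auto
    have e: "Suc (Suc (i + m)) - i = Suc (Suc m)" "Suc (i + m) - i = Suc m" by auto
    have "(cl_cod ^^ m) (cl_cod (cl_cod a)) = (cl_dom ^^ m) (cl_dom (cl_dom b))"
      using glue unfolding 2 e by (simp only: funpow_Suc_right o_apply)
    then have *: "(cl_cod ^^ Suc m) (cl_dom a) = (cl_dom ^^ Suc m) (cl_dom b)"
      "(cl_cod ^^ Suc m) (cl_cod a) = (cl_dom ^^ Suc m) (cl_cod b)"
      using a b 2 wf unfolding funpow_Suc_right by auto
    have W: "cl_wf (CompT i (cl_dom a) (cl_dom b))" "cl_wf (CompT i (cl_cod a) (cl_cod b))"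
      unfolding cl_wf.simps da e using a b *
      by (simp_all only: simp_thms less_add_Suc1 not_less_eq less_Suc_eq_le le_add1)
    have D: "cl_dom (CompT i a b) = CompT i (cl_dom a) (cl_dom b)"
      "cl_cod (CompT i a b) = CompT i (cl_cod a) (cl_cod b)"
      using 2 by auto
    have "cl_dom (cl_dom a) = cl_dom (cl_cod a)" "cl_cod (cl_dom a) = cl_cod (cl_cod a)"
      "cl_dom (cl_dom b) = cl_dom (cl_cod b)" "cl_cod (cl_dom b) = cl_cod (cl_cod b)"
      using a b 2 wf(3) by auto
    moreover have "cl_dim (CompT i a b) = Suc (Suc (i + m))" by (simp only: cl_dim.simps 2)
    moreover have "cl_dim (CompT i (cl_dom a) (cl_dom b)) = Suc (i + m)"
      "cl_dim (CompT i (cl_cod a) (cl_cod b)) = Suc (i + m)"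
      by (simp_all only: cl_dim.simps da)
    ultimately show ?thesis
      unfolding D using W by (simp only: cl_dom.simps cl_cod.simps da simp_thms)
  qed
qed auto

lemma iter_Cl2:
  assumes "i \<le> j"
  shows "iter_dom Cl2 i j t = (cl_dom ^^ (j - i)) t"
    and "iter_cod Cl2 i j t = (cl_cod ^^ (j - i)) t"
proof -
  have "iter_dom Cl2 i j t = (cl_dom ^^ (j - i)) t \<and> iter_cod Cl2 i j t = (cl_cod ^^ (j - i)) t"
    using assms
  proof (induction j arbitrary: t)
    case (Suc j)
    show ?case
    proof (cases "i \<le> j")
      case True
      then have "Suc j - i = Suc (j - i)" by simp
      then show ?thesis
        using True Suc.IH[OF True] by (simp add: funpow_Suc_right del: funpow.simps)
    next
      case False
      then show ?thesis using Suc.prems by simp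
    qed
  qed simp
  then show "iter_dom Cl2 i j t = (cl_dom ^^ (j - i)) t"
    and "iter_cod Cl2 i j t = (cl_cod ^^ (j - i)) t" by auto
qed

lemma composable_Cl2:
  "composable Cl2 i j a b \<longleftrightarrow> cl_wf (CompT i a b) \<and> cl_dim a = j"
proof (cases "i < j")
  case True
  then show ?thesis
    unfolding composable_def iter_Cl2[OF less_imp_le[OF True]] Cl2_simps cl_wf.simps by metis
next
  case False
  then show ?thesis unfolding composable_def by auto
qed

lemma Cl2_omega_graph: "omega_graph Cl2"
proof unfold_locales
  fix t i
  assume "t \<in> Cell Cl2 (Suc i)"
  then show "Dom Cl2 i t \<in> Cell Cl2 i" "Cod Cl2 i t \<in> Cell Cl2 i"
    using cl_boundary[of t] by simp_all
next
  fix t i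
  assume "t \<in> Cell Cl2 (Suc (Suc i))"
  then show "Dom Cl2 i (Dom Cl2 (Suc i) t) = Dom Cl2 i (Cod Cl2 (Suc i) t)"
    "Cod Cl2 i (Dom Cl2 (Suc i) t) = Cod Cl2 i (Cod Cl2 (Suc i) t)"
    using cl_boundary[of t] by simp_all
qed simp_all

lemma Cl2_omega_magma: "omega_magma Cl2"
proof -
  interpret omega_graph Cl2 by (rule Cl2_omega_graph)
  show ?thesis
    by unfold_locales (auto simp: composable_Cl2)
qed

lemma parallel_Cl2:
  "parallel Cl2 i a b \<longleftrightarrow> 0 < i \<longrightarrow> cl_dom a = cl_dom b \<and> cl_cod a = cl_cod b"
  by (cases i) auto

lemma Cl2_relD:
  assumes "(a, b, c) \<in> Cl2_rel i"
  shows "c = cl_bridge a b" "a \<in> Cell Cl2 i" "b \<in> Cell Cl2 i" "parallel Cl2 i a b"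
  using assms unfolding Cl2_rel_def by blast+

lemma Cl2_relI:
  "a \<in> Cell Cl2 i \<Longrightarrow> b \<in> Cell Cl2 i \<Longrightarrow> parallel Cl2 i a b \<Longrightarrow>
    (a, b, cl_bridge a b) \<in> Cl2_rel i"
  unfolding Cl2_rel_def by blast

lemma cl_bridge_cell:
  assumes "a \<in> Cell Cl2 i" "b \<in> Cell Cl2 i" "parallel Cl2 i a b"
  shows "cl_bridge a b \<in> Cell Cl2 (Suc i)"
    "cl_dom (cl_bridge a b) = a" "cl_cod (cl_bridge a b) = b"
  using assms by (simp_all add: cl_bridge_def parallel_Cl2 del: parallel.simps)

lemma Cl2_omega_clique: "omega_clique Cl2 Cl2_rel"
proof -
  interpret omega_magma Cl2 by (rule Cl2_omega_magma)
  show ?thesis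
  proof unfold_locales
    fix a b c i
    assume "(a, b, c) \<in> Cl2_rel i"
    note D = Cl2_relD[OF this]
    show "a \<in> Cell Cl2 i \<and> b \<in> Cell Cl2 i \<and> c \<in> Cell Cl2 (Suc i)"
      unfolding D(1) using D(2,3) cl_bridge_cell(1)[OF D(2-4)] by blast
    show "parallel Cl2 i a b \<and> Dom Cl2 i c = a \<and> Cod Cl2 i c = b"
      unfolding D(1) Cl2_simps using D(4) cl_bridge_cell(2,3)[OF D(2-4)] by blast
  next
    fix a i
    assume a: "a \<in> Cell Cl2 i"
    have "parallel Cl2 i a a" by (cases i) simp_all
    from Cl2_relI[OF a a this] show "(a, a, Idn Cl2 i a) \<in> Cl2_rel i"
      by (simp add: cl_bridge_def)
  next
    fix a b c d i
    assume "(a, b, c) \<in> Cl2_rel i" "(a, b, d) \<in> Cl2_rel i"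
    then show "c = d" by (auto dest!: Cl2_relD(1))
  next
    fix a b j
    assume "a \<in> Cell Cl2 j" "b \<in> Cell Cl2 j" "parallel Cl2 j a b"
    from Cl2_relI[OF this] show "\<exists>c. (a, b, c) \<in> Cl2_rel j" by blast
  qed
qed

lemma K2_omega_graph: "omega_graph K2"
  by unfold_locales (auto simp: K2_def)

lemma K2_simps: "Cell K2 n = {1, 2}" "Dom K2 n k = k" "Cod K2 n k = k" "Idn K2 n k = k"
  by (simp_all add: K2_def)

lemma K2_incl_cell: "k \<in> {1, 2} \<Longrightarrow> cl_wf (K2_incl n k) \<and> cl_dim (K2_incl n k) = n"
  by (induction n) (auto simp: K2_incl_def)

lemma K2_incl: "graph_morphism K2 Cl2 K2_incl"
  using K2_incl_cell
  by (auto simp: graph_morphism_def globular_morphism_def K2_simps K2_incl_def)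

lemma cl_c_bridge:
  assumes "i \<in> {1, 2}" "j \<in> {1, 2}"
  shows "(K2_incl 0 i, K2_incl 0 j, cl_c i j) \<in> Cl2_rel 0"
proof -
  have "PointT i \<in> Cell Cl2 0" "PointT j \<in> Cell Cl2 0" using assms by simp_all
  from Cl2_relI[OF this] show ?thesis by (simp add: cl_c_def K2_incl_def)
qed

primrec cl_eval :: "('a, 'm) omega_magma_scheme \<Rightarrow> (nat \<Rightarrow> ('a \<times> 'a \<times> 'a) set) \<Rightarrow>
    (nat \<Rightarrow> nat \<Rightarrow> 'a) \<Rightarrow> cl_term \<Rightarrow> 'a" where
  "cl_eval M R h (PointT k) = h 0 k"
| "cl_eval M R h (IdT a) = Idn M (cl_dim a) (cl_eval M R h a)"
| "cl_eval M R h (BridgeT a b) =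
     (THE c. (cl_eval M R h a, cl_eval M R h b, c) \<in> R (cl_dim a))"
| "cl_eval M R h (CompT i a b) =
     Comp M i (cl_dim a) (cl_eval M R h a) (cl_eval M R h b)"

lemma cl_size_boundary:
  "cl_wf t \<Longrightarrow> 0 < cl_dim t \<Longrightarrow> size (cl_dom t) < size t \<and> size (cl_cod t) < size t"
  by (induction t) (auto simp: less_Suc_eq_le intro!: add_mono less_imp_le)

lemma (in omega_clique) cl_eval_bridge:
  assumes "a \<in> Cell M j" "b \<in> Cell M j" "parallel M j a b"
  shows "(a, b, THE c. (a, b, c) \<in> R j) \<in> R j"
  using bridge_exists[OF assms] bridge_unique by (metis the_equality)

lemma (in omega_clique) cl_eval_boundary:
  assumes h: "graph_morphism K2 M h" and "cl_wf t"
  shows "cl_eval M R h t \<in> Cell M (cl_dim t) \<and>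
    (\<forall>j. cl_dim t = Suc j \<longrightarrow> cl_eval M R h (cl_dom t) = Dom M j (cl_eval M R h t) \<and>
      cl_eval M R h (cl_cod t) = Cod M j (cl_eval M R h t))"
  using assms(2)
proof (induction "size t" arbitrary: t rule: less_induct)
  case less
  let ?e = "cl_eval M R h"
  have iter: "iter_dom M i (i + m) (?e s) = ?e ((cl_dom ^^ m) s) \<and>
      iter_cod M i (i + m) (?e s) = ?e ((cl_cod ^^ m) s)"
    if "cl_wf s" "size s < size t" "cl_dim s = i + m" for s i m
    using that
  proof (induction m arbitrary: s)
    case 0
    then show ?case by (cases i) auto
  next
    case (Suc m)
    have B: "cl_wf (cl_dom s)" "cl_wf (cl_cod s)"
      "cl_dim (cl_dom s) = i + m" "cl_dim (cl_cod s) = i + m"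
      using cl_boundary[of s] Suc.prems by auto
    have S: "size (cl_dom s) < size t" "size (cl_cod s) < size t"
      using cl_size_boundary[of s] Suc.prems by auto
    have "?e (cl_dom s) = Dom M (i + m) (?e s)" "?e (cl_cod s) = Cod M (i + m) (?e s)"
      using less.hyps[OF Suc.prems(2,1)] Suc.prems(3) by auto
    then show ?case
      using Suc.IH[OF B(1) S(1) B(3)] Suc.IH[OF B(2) S(2) B(4)]
      by (simp add: funpow_Suc_right del: funpow.simps)
  qed
  show ?case
  proof (cases t)
    case (PointT k)
    then show ?thesis
      using less.prems h by (auto simp: graph_morphism_def globular_morphism_def K2_def)
  next
    case (IdT a)
    have "?e a \<in> Cell M (cl_dim a)" using less IdT by simp
    then show ?thesis using IdT by (auto simp: id_cell dom_id cod_id)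
  next
    case (BridgeT a b)
    have wf: "cl_wf a" "cl_wf b" "cl_dim b = cl_dim a"
      "0 < cl_dim a \<Longrightarrow> cl_dom a = cl_dom b" "0 < cl_dim a \<Longrightarrow> cl_cod a = cl_cod b"
      using less.prems BridgeT by auto
    have sz: "size a < size t" "size b < size t" using BridgeT by auto
    note A = less.hyps[OF sz(1) wf(1)] and B = less.hyps[OF sz(2) wf(2)]
    have "parallel M (cl_dim a) (?e a) (?e b)"
    proof (cases "cl_dim a")
      case (Suc j)
      have "Dom M j (?e a) = ?e (cl_dom a)" "Cod M j (?e a) = ?e (cl_cod a)"
        "Dom M j (?e b) = ?e (cl_dom b)" "Cod M j (?e b) = ?e (cl_cod b)"
        using A B Suc wf(3) by auto
      then show ?thesis using wf(4,5) Suc by simp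
    qed simp
    then have "(?e a, ?e b, ?e t) \<in> R (cl_dim a)"
      using cl_eval_bridge A B wf(3) BridgeT by auto
    then show ?thesis using bridge_cells bridge_boundary BridgeT by auto
  next
    case (CompT i a b)
    have wf: "cl_wf a" "cl_wf b" "cl_dim b = cl_dim a" "i < cl_dim a"
      and glue: "(cl_cod ^^ (cl_dim a - i)) a = (cl_dom ^^ (cl_dim a - i)) b"
      using less.prems CompT by auto
    have sz: "size a < size t" "size b < size t" using CompT by auto
    note A = less.hyps[OF sz(1) wf(1)] and B = less.hyps[OF sz(2) wf(2)]
    obtain n where n: "cl_dim a = i + Suc n" using wf(4) less_imp_Suc_add by fastforce
    have comp: "composable M i (cl_dim a) (?e a) (?e b)"
      unfolding composable_def
      using A B wf glue iter[OF wf(1) sz(1), of i "Suc n"] iter[OF wf(2) sz(2), of i "Suc n"] n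
      by (simp del: iter_dom.simps iter_cod.simps funpow.simps)
    have d: "cl_dim (cl_dom a) = i + n" "cl_dim (cl_cod a) = i + n"
      using cl_boundary[OF wf(1)] n by auto
    have E: "?e (cl_dom a) = Dom M (i + n) (?e a)" "?e (cl_cod a) = Cod M (i + n) (?e a)"
      "?e (cl_dom b) = Dom M (i + n) (?e b)" "?e (cl_cod b) = Cod M (i + n) (?e b)"
      using A B n wf(3) by auto
    show ?thesis
    proof (cases n)
      case 0
      then show ?thesis
        using comp comp_cell[OF comp] dom_comp[of i] cod_comp[of i] CompT n E by auto
    next
      case (Suc m)
      then have "i < i + n" by simp
      have cm: "composable M i (Suc (i + n)) (?e a) (?e b)" using comp n by simp
      show ?thesis
        using comp_cell[OF comp] dom_comp_lower[OF cm \<open>i < i + n\<close>]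
          cod_comp_lower[OF cm \<open>i < i + n\<close>] CompT n E d Suc by auto
    qed
  qed
qed

theorem Cl2_extension_exists:
  assumes "omega_clique M R" and h: "graph_morphism K2 M h"
  shows "\<exists>F. bridge_morphism Cl2 Cl2_rel M R F \<and>
    (\<forall>n. \<forall>k\<in>Cell K2 n. F n (K2_incl n k) = h n k)"
proof -
  interpret omega_clique M R by fact
  let ?e = "cl_eval M R h"
  note E = cl_eval_boundary[OF h]
  have "graph_morphism Cl2 M (\<lambda>_. ?e)"
    using E by (auto simp: graph_morphism_def globular_morphism_def)
  then have mag: "magma_morphism Cl2 M (\<lambda>_. ?e)"
    by (auto simp: magma_morphism_def composable_Cl2)
  have "(?e a, ?e b, ?e c) \<in> R i" if "(a, b, c) \<in> Cl2_rel i" for a b c i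
  proof -
    note c = Cl2_relD(1)[OF that] and ab = Cl2_relD(2-4)[OF that]
    have wf: "cl_wf a" "cl_wf b" "cl_dim a = i" "cl_dim b = i"
      using ab(1,2) by simp_all
    show ?thesis
    proof (cases "a = b")
      case True
      then show ?thesis using c bridge_refl E[OF wf(1)] wf by (simp add: cl_bridge_def)
    next
      case False
      have "parallel M i (?e a) (?e b)"
      proof (cases i)
        case (Suc j)
        have "Dom M j (?e a) = ?e (cl_dom a)" "Cod M j (?e a) = ?e (cl_cod a)"
          "Dom M j (?e b) = ?e (cl_dom b)" "Cod M j (?e b) = ?e (cl_cod b)"
          using E[OF wf(1)] E[OF wf(2)] wf Suc by auto
        then show ?thesis using ab(3) Suc by (simp add: parallel_Cl2 del: parallel.simps(2)) simp
      qed simp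
      then show ?thesis
        using cl_eval_bridge E[OF wf(1)] E[OF wf(2)] wf c False by (auto simp: cl_bridge_def)
    qed
  qed
  moreover have "?e (K2_incl n k) = h n k" if "k \<in> {1, 2}" for n k
  proof (induction n)
    case (Suc n)
    have "cl_dim (K2_incl n k) = n" by (induction n) (auto simp: K2_incl_def)
    moreover have "h (Suc n) k = Idn M n (h n k)"
      using h that by (auto simp: graph_morphism_def K2_def)
    ultimately show ?case using Suc by (simp add: K2_incl_def)
  qed (simp add: K2_incl_def)
  ultimately show ?thesis
    using mag by (intro exI[of _ "\<lambda>_. ?e"]) (auto simp: bridge_morphism_def K2_def)
qed

theorem Cl2_extension_unique:
  assumes "omega_clique M R"
    and F: "bridge_morphism Cl2 Cl2_rel M R F" and G: "bridge_morphism Cl2 Cl2_rel M R G"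
    and agree: "\<And>n k. k \<in> Cell K2 n \<Longrightarrow> F n (K2_incl n k) = G n (K2_incl n k)"
    and "t \<in> Cell Cl2 n"
  shows "F n t = G n t"
proof -
  interpret omega_clique M R by fact
  have id: "F (Suc i) (IdT a) = Idn M i (F i a)" "G (Suc i) (IdT a) = Idn M i (G i a)"
    if "cl_wf a" "cl_dim a = i" for a i
    using F G that by (auto simp: bridge_morphism_def magma_morphism_def graph_morphism_def)
  have comp: "F j (CompT i a b) = Comp M i j (F j a) (F j b)"
    "G j (CompT i a b) = Comp M i j (G j a) (G j b)"
    if "composable Cl2 i j a b" for i j a b
  proof -
    have "Comp Cl2 i j a b = CompT i a b" by simp
    then show "F j (CompT i a b) = Comp M i j (F j a) (F j b)"
      "G j (CompT i a b) = Comp M i j (G j a) (G j b)"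
      using F G that unfolding bridge_morphism_def magma_morphism_def by metis+
  qed
  have "cl_wf t \<Longrightarrow> F (cl_dim t) t = G (cl_dim t) t" for t
  proof (induction t)
    case (PointT k)
    then show ?case using agree[of k 0] by (simp add: K2_def K2_incl_def)
  next
    case (IdT a)
    then show ?case using id by simp
  next
    case (BridgeT a b)
    have wf: "cl_wf a" "cl_wf b" "cl_dim b = cl_dim a" "a \<noteq> b"
      "0 < cl_dim a \<longrightarrow> cl_dom a = cl_dom b \<and> cl_cod a = cl_cod b"
      using BridgeT.prems unfolding cl_wf.simps by metis+
    have "(a, b, cl_bridge a b) \<in> Cl2_rel (cl_dim a)"
      by (rule Cl2_relI) (use wf parallel_Cl2 in simp_all)
    then have "(a, b, BridgeT a b) \<in> Cl2_rel (cl_dim a)" using wf(4) by (simp only: cl_bridge_def if_False)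
    then have "(F (cl_dim a) a, F (cl_dim a) b, F (Suc (cl_dim a)) (BridgeT a b)) \<in> R (cl_dim a)"
      "(G (cl_dim a) a, G (cl_dim a) b, G (Suc (cl_dim a)) (BridgeT a b)) \<in> R (cl_dim a)"
      using F G by (auto simp: bridge_morphism_def)
    then show ?case using BridgeT bridge_unique by simp
  next
    case (CompT i a b)
    then have "composable Cl2 i (cl_dim a) a b" by (simp only: composable_Cl2)
    from comp[OF this] show ?case using CompT by (simp only: cl_wf.simps cl_dim.simps)
  qed
  then show ?thesis using assms(5) by auto
qed

section \<open>Internal equivalences\<close>

text \<open>\<open>hom_magma M n a b\<close> is the hom omega magma of two \<open>n\<close>-cells.\<close>

definition hom_magma :: "('a, 'm) omega_magma_scheme \<Rightarrow> nat \<Rightarrow> 'a \<Rightarrow> 'a \<Rightarrow> 'a omega_magma" where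
  "hom_magma M n a b =
     \<lparr>Cell = \<lambda>j. {c \<in> Cell M (Suc n + j).
         iter_dom M n (Suc n + j) c = a \<and> iter_cod M n (Suc n + j) c = b},
      Dom = \<lambda>j. Dom M (Suc n + j),
      Cod = \<lambda>j. Cod M (Suc n + j),
      Idn = \<lambda>j. Idn M (Suc n + j),
      Comp = \<lambda>k j. Comp M (Suc n + k) (Suc n + j)\<rparr>"

fun el :: "('a, 'm) omega_magma_scheme \<Rightarrow> nat \<Rightarrow> 'a set" where
  "el M 0 = {}"
| "el M (Suc 0) = {f \<in> Cell M 1. f \<in> Idn M 0 ` Cell M 0 \<or>
     (\<exists>H. magma_morphism Cl2 M H \<and> H 1 (cl_c 1 2) = f)}"
| "el M (Suc (Suc n)) = {f \<in> Cell M (Suc (Suc n)). f \<in> Idn M (Suc n) ` Cell M (Suc n) \<or>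
     (\<exists>H. magma_morphism Cl2
            (hom_magma M n (iter_dom M n (Suc (Suc n)) f) (iter_cod M n (Suc (Suc n)) f)) H
        \<and> H 1 (cl_c 1 2) = f)}"

inductive_set comp_closure :: "('a, 'm) omega_magma_scheme \<Rightarrow> (nat \<Rightarrow> 'a set) \<Rightarrow> (nat \<times> 'a) set"
  for M and S where
  base: "x \<in> S j \<Longrightarrow> (j, x) \<in> comp_closure M S"
| comp: "(j, a) \<in> comp_closure M S \<Longrightarrow> (j, b) \<in> comp_closure M S \<Longrightarrow> composable M i j a b \<Longrightarrow>
    (j, Comp M i j a b) \<in> comp_closure M S"

definition composites :: "('a, 'm) omega_magma_scheme \<Rightarrow> (nat \<Rightarrow> 'a set) \<Rightarrow> nat \<Rightarrow> 'a set" where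
  "composites M S j = {x. (j, x) \<in> comp_closure M S}"

fun inv_up_to :: "('a, 'm) omega_magma_scheme \<Rightarrow> (nat \<Rightarrow> 'a set) \<Rightarrow> nat \<Rightarrow> 'a set" where
  "inv_up_to M S 0 = {}"
| "inv_up_to M S (Suc k) = {f \<in> Cell M (Suc k). \<exists>g\<in>Cell M (Suc k).
     Dom M k g = Cod M k f \<and> Cod M k g = Dom M k f \<and>
     (\<exists>h\<in>S (Suc (Suc k)). \<exists>h'\<in>S (Suc (Suc k)).
        Dom M (Suc k) h = Comp M k (Suc k) f g \<and> Cod M (Suc k) h = Idn M k (Dom M k f) \<and>
        Dom M (Suc k) h' = Comp M k (Suc k) g f \<and> Cod M (Suc k) h' = Idn M k (Cod M k f))}"

text \<open>\<open>Eq_stage M n\<close> is the stage with index \<open>n + 1\<close> in the usual numbering from \<open>1\<close>.\<close>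

primrec Eq_stage :: "('a, 'm) omega_magma_scheme \<Rightarrow> nat \<Rightarrow> nat \<Rightarrow> 'a set" where
  "Eq_stage M 0 = composites M (el M)"
| "Eq_stage M (Suc n) =
     composites M (\<lambda>k. Eq_stage M n k \<union> inv_up_to M (Eq_stage M n) k)"

definition Eq_cells :: "('a, 'm) omega_magma_scheme \<Rightarrow> nat \<Rightarrow> 'a set" where
  "Eq_cells M k = (\<Union>n. Eq_stage M n k)"


section \<open>Weak equivalences\<close>

definition equiv_rel :: "('a, 'm) omega_magma_scheme \<Rightarrow> ('a \<times> 'a) set" where
  "equiv_rel M = {(a, b). a \<in> Cell M 0 \<and> b \<in> Cell M 0 \<and>
     (\<exists>f\<in>Eq_cells M 1. Dom M 0 f = a \<and> Cod M 0 f = b)}"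

context omega_magma
begin

lemma iter_dom_Cod:
  "i < j \<Longrightarrow> x \<in> Cell X (Suc j) \<Longrightarrow>
    iter_dom X i j (Cod X j x) = iter_dom X i j (Dom X j x)
    \<and> iter_cod X i j (Dom X j x) = iter_cod X i j (Cod X j x)"
  by (cases j) (auto simp: dom_dom cod_dom)

lemma composable_boundary:
  assumes "composable X i (Suc j) a b" "i < j"
  shows "composable X i j (Dom X j a) (Dom X j b)" "composable X i j (Cod X j a) (Cod X j b)"
  using assms iter_dom_Cod[OF assms(2), of a] iter_dom_Cod[OF assms(2), of b]
  by (auto simp: composable_def dom_cell cod_cell)

lemma iter_comp:
  "composable X i j a b \<Longrightarrow> k \<le> i \<Longrightarrow>
    iter_dom X k j (Comp X i j a b) = iter_dom X k j a \<and>
    iter_cod X k j (Comp X i j a b) = iter_cod X k j b"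
proof (induction j arbitrary: a b)
  case (Suc j)
  have "i \<le> j" "k \<le> j" using Suc.prems by (auto simp: composable_def)
  then consider "i = j" | "i < j" by linarith
  then show ?case
  proof cases
    case 1
    then show ?thesis using Suc.prems dom_comp cod_comp \<open>k \<le> j\<close> by auto
  next
    case 2
    then show ?thesis
      using Suc.IH[OF composable_boundary(1)[OF Suc.prems(1) 2] Suc.prems(2)]
        Suc.IH[OF composable_boundary(2)[OF Suc.prems(1) 2] Suc.prems(2)]
        dom_comp_lower[OF Suc.prems(1) 2] cod_comp_lower[OF Suc.prems(1) 2] \<open>k \<le> j\<close> by simp
  qed
qed (simp add: composable_def)

lemma hom_magma_simps [simp]:
  "x \<in> Cell (hom_magma X n a b) j \<longleftrightarrow> x \<in> Cell X (Suc n + j) \<and>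
     iter_dom X n (Suc n + j) x = a \<and> iter_cod X n (Suc n + j) x = b"
  "Dom (hom_magma X n a b) j = Dom X (Suc n + j)"
  "Cod (hom_magma X n a b) j = Cod X (Suc n + j)"
  "Idn (hom_magma X n a b) j = Idn X (Suc n + j)"
  "Comp (hom_magma X n a b) k j = Comp X (Suc n + k) (Suc n + j)"
  by (simp_all add: hom_magma_def)

lemma iter_hom_magma:
  "k \<le> j \<Longrightarrow> iter_dom (hom_magma X n a b) k j x = iter_dom X (Suc n + k) (Suc n + j) x
    \<and> iter_cod (hom_magma X n a b) k j x = iter_cod X (Suc n + k) (Suc n + j) x"
  by (induction j arbitrary: x) (auto simp: le_Suc_eq)

lemma composable_hom_magma:
  "composable (hom_magma X n a b) i j x y \<Longrightarrow> composable X (Suc n + i) (Suc n + j) x y"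
  using iter_hom_magma[of i j] by (auto simp: composable_def simp del: iter_dom.simps iter_cod.simps)

lemma omega_magma_hom: "omega_magma (hom_magma X n a b)"
proof unfold_locales
  fix i j x y
  assume c: "composable (hom_magma X n a b) i j x y"
  then have "x \<in> Cell (hom_magma X n a b) j" "y \<in> Cell (hom_magma X n a b) j"
    by (auto simp: composable_def simp del: iter_dom.simps iter_cod.simps hom_magma_simps)
  then show "Comp (hom_magma X n a b) i j x y \<in> Cell (hom_magma X n a b) j"
    using comp_cell[OF composable_hom_magma[OF c]] iter_comp[OF composable_hom_magma[OF c], of n]
    by (simp del: iter_dom.simps iter_cod.simps)
next
  fix i x y
  assume "composable (hom_magma X n a b) i (Suc i) x y"
  from composable_hom_magma[OF this]
  show "Dom (hom_magma X n a b) i (Comp (hom_magma X n a b) i (Suc i) x y)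
      = Dom (hom_magma X n a b) i x"
    "Cod (hom_magma X n a b) i (Comp (hom_magma X n a b) i (Suc i) x y)
      = Cod (hom_magma X n a b) i y"
    by (auto simp: dom_comp cod_comp)
next
  fix i j x y
  assume "composable (hom_magma X n a b) i (Suc j) x y" "i < j"
  with composable_hom_magma[OF this(1)]
  show "Dom (hom_magma X n a b) j (Comp (hom_magma X n a b) i (Suc j) x y)
      = Comp (hom_magma X n a b) i j (Dom (hom_magma X n a b) j x) (Dom (hom_magma X n a b) j y)"
    "Cod (hom_magma X n a b) j (Comp (hom_magma X n a b) i (Suc j) x y)
      = Comp (hom_magma X n a b) i j (Cod (hom_magma X n a b) j x) (Cod (hom_magma X n a b) j y)"
    by (auto simp: dom_comp_lower cod_comp_lower)
next
  fix x i
  assume "x \<in> Cell (hom_magma X n a b) (Suc i)"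
  then show "Dom (hom_magma X n a b) i x \<in> Cell (hom_magma X n a b) i"
    "Cod (hom_magma X n a b) i x \<in> Cell (hom_magma X n a b) i"
    using iter_dom_Cod[of n "Suc n + i" x] by (auto simp: dom_cell cod_cell)
next
  fix x i
  assume "x \<in> Cell (hom_magma X n a b) (Suc (Suc i))"
  then show "Dom (hom_magma X n a b) i (Dom (hom_magma X n a b) (Suc i) x)
      = Dom (hom_magma X n a b) i (Cod (hom_magma X n a b) (Suc i) x)"
    "Cod (hom_magma X n a b) i (Dom (hom_magma X n a b) (Suc i) x)
      = Cod (hom_magma X n a b) i (Cod (hom_magma X n a b) (Suc i) x)"
    by (auto simp: dom_dom cod_dom)
next
  fix x i
  assume "x \<in> Cell (hom_magma X n a b) i"
  then show "Idn (hom_magma X n a b) i x \<in> Cell (hom_magma X n a b) (Suc i)"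
    "Dom (hom_magma X n a b) i (Idn (hom_magma X n a b) i x) = x"
    "Cod (hom_magma X n a b) i (Idn (hom_magma X n a b) i x) = x"
    by (auto simp: id_cell dom_id cod_id)
qed

end

lemma iter_morphism:
  assumes "globular_set X" "globular_morphism X Y F" "x \<in> Cell X j" "i \<le> j"
  shows "F i (iter_dom X i j x) = iter_dom Y i j (F j x)
    \<and> F i (iter_cod X i j x) = iter_cod Y i j (F j x)"
  using assms(3,4)
proof (induction j arbitrary: x)
  case (Suc j)
  interpret globular_set X by fact
  show ?case
  proof (cases "i \<le> j")
    case True
    then show ?thesis
      using Suc.IH[OF dom_cell[OF Suc.prems(1)]] Suc.IH[OF cod_cell[OF Suc.prems(1)]]
        assms(2) Suc.prems(1) by (simp add: globular_morphism_def)
  next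
    case False
    then show ?thesis using Suc.prems le_Suc_eq by auto
  qed
qed simp

lemma composable_morphism:
  assumes "globular_set X" "globular_morphism X Y F" "composable X i j a b"
  shows "composable Y i j (F j a) (F j b)"
  using iter_morphism[OF assms(1,2), of a j i] iter_morphism[OF assms(1,2), of b j i] assms(2,3)
  by (simp add: composable_def globular_morphism_def)

lemma magma_morphism_comp:
  assumes "omega_magma X" "magma_morphism X Y F" "magma_morphism Y Z G"
  shows "magma_morphism X Z (\<lambda>n x. G n (F n x))"
proof -
  interpret omega_magma X by fact
  have "globular_morphism X Y F"
    using assms(2) by (simp add: magma_morphism_def graph_morphism_def)
  from composable_morphism[OF globular_set_axioms this] show ?thesis
    using assms(2,3)
    by (simp add: magma_morphism_def graph_morphism_def globular_morphism_def)
qed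

context omega_magma
begin

lemma composites_cell:
  assumes "\<And>j. S j \<subseteq> Cell X j" and "x \<in> composites X S j"
  shows "x \<in> Cell X j"
proof -
  have "(j, x) \<in> comp_closure X S \<Longrightarrow> x \<in> Cell X j" for j x
    by (induction j x rule: comp_closure.induct) (use assms(1) comp_cell in blast)+
  then show ?thesis using assms(2) by (simp add: composites_def)
qed

lemma el_cell: "el X j \<subseteq> Cell X j"
  by (induction X j rule: el.induct) auto

lemma inv_up_to_cell: "inv_up_to X S j \<subseteq> Cell X j"
  by (cases j) auto

lemma Eq_stage_cell: "Eq_stage X n j \<subseteq> Cell X j"
proof (induction n arbitrary: j)
  case 0
  show ?case using composites_cell[OF el_cell] by auto
next
  case (Suc n)
  have "Eq_stage X n j \<union> inv_up_to X (Eq_stage X n) j \<subseteq> Cell X j" for j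
    using Suc inv_up_to_cell by auto
  from composites_cell[OF this] show ?case by (auto simp only: Eq_stage.simps)
qed

lemma composites_base: "x \<in> S j \<Longrightarrow> x \<in> composites X S j"
  by (simp add: composites_def comp_closure.base)

lemma composites_comp:
  "a \<in> composites X S j \<Longrightarrow> b \<in> composites X S j \<Longrightarrow> composable X i j a b \<Longrightarrow>
    Comp X i j a b \<in> composites X S j"
  by (auto simp: composites_def intro: comp_closure.comp)

lemma Eq_stage_mono: "m \<le> n \<Longrightarrow> Eq_stage X m j \<subseteq> Eq_stage X n j"
  by (rule lift_Suc_mono_le[of "\<lambda>n. Eq_stage X n j"]) (auto intro: composites_base)

lemma composable_1:
  "composable X 0 (Suc 0) f g \<longleftrightarrow>
    f \<in> Cell X 1 \<and> g \<in> Cell X 1 \<and> Cod X 0 f = Dom X 0 g"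
  by (simp add: composable_def)

lemma Eq_stage_comp:
  assumes "f \<in> Eq_stage X n 1" "g \<in> Eq_stage X n 1" "Cod X 0 f = Dom X 0 g"
  shows "Comp X 0 1 f g \<in> Eq_stage X n 1"
proof -
  have "composable X 0 1 f g" using assms Eq_stage_cell composable_1 by auto
  then show ?thesis using assms by (cases n) (auto intro: composites_comp)
qed

definition reversible :: "(nat \<Rightarrow> 'a set) \<Rightarrow> bool" where
  "reversible S \<longleftrightarrow> (\<forall>f\<in>S 1. \<exists>g\<in>S 1. Dom X 0 g = Cod X 0 f \<and> Cod X 0 g = Dom X 0 f)"

lemma reversible_composites:
  assumes "\<And>j. S j \<subseteq> Cell X j" and "reversible S"
  shows "reversible (composites X S)"
proof -
  have "j = 1 \<longrightarrow> (\<exists>g\<in>composites X S 1. Dom X 0 g = Cod X 0 f \<and> Cod X 0 g = Dom X 0 f)"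
    if "(j, f) \<in> comp_closure X S" for j f
    using that
  proof (induction j f rule: comp_closure.induct)
    case (base x j)
    then show ?case using assms(2) composites_base unfolding reversible_def by blast
  next
    case (comp j a b i)
    show ?case
    proof
      assume j: "j = 1"
      then have i: "i = 0" using comp.hyps by (auto simp: composable_def)
      have c: "composable X 0 (Suc 0) a b" using comp.hyps i j by simp
      obtain a' where a': "a' \<in> composites X S 1" "Dom X 0 a' = Cod X 0 a" "Cod X 0 a' = Dom X 0 a"
        using comp.IH j by auto
      obtain b' where b': "b' \<in> composites X S 1" "Dom X 0 b' = Cod X 0 b" "Cod X 0 b' = Dom X 0 b"
        using comp.IH j by auto
      have c': "composable X 0 (Suc 0) b' a'"
        using a' b' c composites_cell[OF assms(1)] by (auto simp: composable_1)
      then show "\<exists>g\<in>composites X S 1. Dom X 0 g = Cod X 0 (Comp X i j a b) \<and>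
          Cod X 0 g = Dom X 0 (Comp X i j a b)"
        using i j a' b' c composites_comp[OF b'(1) a'(1), of 0] dom_comp cod_comp
        by (intro bexI[of _ "Comp X 0 1 b' a'"]) auto
    qed
  qed
  then show ?thesis by (auto simp: reversible_def composites_def)
qed

lemma el_1: "el X 1 = {f \<in> Cell X 1. f \<in> Idn X 0 ` Cell X 0 \<or>
    (\<exists>H. magma_morphism Cl2 X H \<and> H 1 (cl_c 1 2) = f)}"
  by (simp only: el.simps One_nat_def)

lemma reversible_el: "reversible (el X)"
  unfolding reversible_def
proof
  fix f assume "f \<in> el X 1"
  then have f: "f \<in> Cell X 1"
    and "f \<in> Idn X 0 ` Cell X 0 \<or> (\<exists>H. magma_morphism Cl2 X H \<and> H 1 (cl_c 1 2) = f)"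
    unfolding el_1 by blast+
  from this(2) show "\<exists>g\<in>el X 1. Dom X 0 g = Cod X 0 f \<and> Cod X 0 g = Dom X 0 f"
  proof
    assume "f \<in> Idn X 0 ` Cell X 0"
    then obtain a where a: "a \<in> Cell X 0" "f = Idn X 0 a" by blast
    have "Dom X 0 f = Cod X 0 f" unfolding a(2) dom_id[OF a(1)] cod_id[OF a(1)] ..
    with \<open>f \<in> el X 1\<close> show ?thesis by metis
  next
    assume "\<exists>H. magma_morphism Cl2 X H \<and> H 1 (cl_c 1 2) = f"
    then obtain H where H: "magma_morphism Cl2 X H" "H 1 (cl_c 1 2) = f" by blast
    define sw where "sw = (\<lambda>n k. K2_incl n (3 - k))"
    have "graph_morphism K2 Cl2 sw"
      using K2_incl_cell
      by (auto simp: graph_morphism_def globular_morphism_def K2_def sw_def K2_incl_def)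
    then obtain F where F: "bridge_morphism Cl2 Cl2_rel Cl2 Cl2_rel F"
      and Fk: "\<And>n k. k \<in> {1, 2} \<Longrightarrow> F n (K2_incl n k) = sw n k"
      using Cl2_extension_exists[OF Cl2_omega_clique, of sw] unfolding K2_simps by blast
    have F0: "F 0 (PointT 1) = PointT 2" "F 0 (PointT 2) = PointT 1"
      using Fk[of 1 0] Fk[of 2 0] by (auto simp: K2_incl_def sw_def)
    have R: "(F 0 (PointT 1), F 0 (PointT 2), F (Suc 0) (cl_c 1 2)) \<in> Cl2_rel 0"
      using F cl_c_bridge[of 1 2] by (auto simp: bridge_morphism_def K2_incl_def)
    have F1: "F 1 (cl_c 1 2) = cl_c 2 1"
      using Cl2_relD(1)[OF R[unfolded F0]] unfolding cl_c_def One_nat_def .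
    let ?H = "\<lambda>n t. H n (F n t)"
    have FC: "magma_morphism Cl2 Cl2 F" using F by (simp add: bridge_morphism_def)
    have glF: "\<And>i x. x \<in> Cell Cl2 i \<Longrightarrow> F i x \<in> Cell Cl2 i"
      "\<And>i x. x \<in> Cell Cl2 (Suc i) \<Longrightarrow> F i (Dom Cl2 i x) = Dom Cl2 i (F (Suc i) x)"
      "\<And>i x. x \<in> Cell Cl2 (Suc i) \<Longrightarrow> F i (Cod Cl2 i x) = Cod Cl2 i (F (Suc i) x)"
      using FC unfolding magma_morphism_def graph_morphism_def globular_morphism_def by blast+
    have glH: "\<And>i x. x \<in> Cell Cl2 i \<Longrightarrow> H i x \<in> Cell X i"
      "\<And>i x. x \<in> Cell Cl2 (Suc i) \<Longrightarrow> H i (Dom Cl2 i x) = Dom X i (H (Suc i) x)"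
      "\<And>i x. x \<in> Cell Cl2 (Suc i) \<Longrightarrow> H i (Cod Cl2 i x) = Cod X i (H (Suc i) x)"
      using H(1) unfolding magma_morphism_def graph_morphism_def globular_morphism_def by blast+
    have comp: "magma_morphism Cl2 X ?H"
      by (rule magma_morphism_comp[OF Cl2_omega_magma FC H(1)])
    have c: "cl_c 1 2 \<in> Cell Cl2 (Suc 0)" "cl_c 2 1 \<in> Cell Cl2 (Suc 0)"
      by (auto simp: cl_c_def cl_bridge_def)
    have g: "?H 1 (cl_c 1 2) = H 1 (cl_c 2 1)" using F1 by simp
    have "H 1 (cl_c 2 1) \<in> el X 1"
    proof -
      have "H 1 (cl_c 2 1) \<in> Cell X 1" using glH(1)[OF c(2)] unfolding One_nat_def .
      moreover have "\<exists>H'. magma_morphism Cl2 X H' \<and> H' 1 (cl_c 1 2) = H 1 (cl_c 2 1)"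
        by (rule exI[of _ ?H]) (rule conjI[OF comp g])
      ultimately show ?thesis unfolding el_1 by (intro CollectI conjI disjI2)
    qed
    moreover have b: "cl_dom (cl_c 1 2) = PointT 1" "cl_cod (cl_c 1 2) = PointT 2"
      "cl_dom (cl_c 2 1) = PointT 2" "cl_cod (cl_c 2 1) = PointT 1"
      by (auto simp: cl_c_def cl_bridge_def)
    have "Dom X 0 (H 1 (cl_c 2 1)) = Cod X 0 f" "Cod X 0 (H 1 (cl_c 2 1)) = Dom X 0 f"
      using glH(2,3)[OF c(1)] glH(2,3)[OF c(2)]
      unfolding Cl2_simps b One_nat_def[symmetric] H(2) by simp_all
    ultimately show ?thesis by blast
  qed
qed

lemma reversible_Eq_stage: "reversible (Eq_stage X n)"
proof (induction n)
  case 0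
  show ?case
    unfolding Eq_stage.simps by (rule reversible_composites[OF el_cell reversible_el])
next
  case (Suc n)
  let ?S = "\<lambda>k. Eq_stage X n k \<union> inv_up_to X (Eq_stage X n) k"
  have "reversible ?S"
    unfolding reversible_def
  proof
    fix f assume "f \<in> ?S 1"
    then consider "f \<in> Eq_stage X n 1" | "f \<in> inv_up_to X (Eq_stage X n) 1" by blast
    then show "\<exists>g\<in>?S 1. Dom X 0 g = Cod X 0 f \<and> Cod X 0 g = Dom X 0 f"
    proof cases
      case 1
      from bspec[OF Suc[unfolded reversible_def] this] show ?thesis by blast
    next
      case 2
      then obtain g h h' where "f \<in> Cell X 1" "g \<in> Cell X 1"
        and g: "Dom X 0 g = Cod X 0 f" "Cod X 0 g = Dom X 0 f"
        and "h \<in> Eq_stage X n 2" "h' \<in> Eq_stage X n 2"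
        "Dom X 1 h = Comp X 0 1 f g" "Cod X 1 h = Idn X 0 (Dom X 0 f)"
        "Dom X 1 h' = Comp X 0 1 g f" "Cod X 1 h' = Idn X 0 (Cod X 0 f)"
        unfolding One_nat_def numeral_2_eq_2 inv_up_to.simps by blast
      then have "g \<in> inv_up_to X (Eq_stage X n) 1"
        unfolding One_nat_def numeral_2_eq_2 inv_up_to.simps
        by (intro CollectI conjI bexI[of _ f] bexI[of _ h'] bexI[of _ h]) simp_all
      then show ?thesis using g by blast
    qed
  qed
  have "?S j \<subseteq> Cell X j" for j using Eq_stage_cell inv_up_to_cell by (rule Un_least)
  from reversible_composites[OF this \<open>reversible ?S\<close>]
  show ?case unfolding Eq_stage.simps .
qed

lemma equiv_relI: "f \<in> Eq_stage X n 1 \<Longrightarrow> (Dom X 0 f, Cod X 0 f) \<in> equiv_rel X"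
proof -
  assume f: "f \<in> Eq_stage X n 1"
  have "f \<in> Cell X (Suc 0)" using subsetD[OF Eq_stage_cell f] by (simp only: One_nat_def)
  then have "Dom X 0 f \<in> Cell X 0" "Cod X 0 f \<in> Cell X 0" by (rule dom_cell, rule cod_cell)
  moreover have "f \<in> Eq_cells X 1" using f unfolding Eq_cells_def by blast
  ultimately show "(Dom X 0 f, Cod X 0 f) \<in> equiv_rel X" unfolding equiv_rel_def by blast
qed

lemma equiv_relE:
  assumes "(a, b) \<in> equiv_rel X"
  obtains n f where "f \<in> Eq_stage X n 1" "Dom X 0 f = a" "Cod X 0 f = b"
  using assms unfolding equiv_rel_def Eq_cells_def by blast

lemma equiv_equiv_rel: "equiv (Cell X 0) (equiv_rel X)"
proof (rule equivI)
  show "equiv_rel X \<subseteq> Cell X 0 \<times> Cell X 0" unfolding equiv_rel_def by blast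
  show "refl_on (Cell X 0) (equiv_rel X)"
  proof (rule refl_onI)
    fix a assume a: "a \<in> Cell X 0"
    then have "Idn X 0 a \<in> el X 1" using id_cell[OF a] by simp
    then have "Idn X 0 a \<in> Eq_stage X 0 1" unfolding Eq_stage.simps by (rule composites_base)
    from equiv_relI[OF this] show "(a, a) \<in> equiv_rel X" by (simp only: dom_id[OF a] cod_id[OF a])
  qed
  show "sym (equiv_rel X)"
  proof (rule symI)
    fix a b assume "(a, b) \<in> equiv_rel X"
    then obtain n f where "f \<in> Eq_stage X n 1" and f: "Dom X 0 f = a" "Cod X 0 f = b"
      by (rule equiv_relE)
    then obtain g where "g \<in> Eq_stage X n 1" and g: "Dom X 0 g = b" "Cod X 0 g = a"
      using reversible_Eq_stage[of n] unfolding reversible_def by metis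
    from equiv_relI[OF this(1)] show "(b, a) \<in> equiv_rel X" unfolding g .
  qed
  show "trans (equiv_rel X)"
  proof (rule transI)
    fix a b c assume ab: "(a, b) \<in> equiv_rel X" and bc: "(b, c) \<in> equiv_rel X"
    obtain m f where f: "f \<in> Eq_stage X m 1" "Dom X 0 f = a" "Cod X 0 f = b"
      using ab by (rule equiv_relE)
    obtain n g where g: "g \<in> Eq_stage X n 1" "Dom X 0 g = b" "Cod X 0 g = c"
      using bc by (rule equiv_relE)
    have F: "f \<in> Eq_stage X (max m n) 1" by (rule subsetD[OF Eq_stage_mono f(1)]) simp
    have G: "g \<in> Eq_stage X (max m n) 1" by (rule subsetD[OF Eq_stage_mono g(1)]) simp
    have "Cod X 0 f = Dom X 0 g" unfolding f(3) g(2) ..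
    note FG = Eq_stage_comp[OF F G this]
    have "composable X 0 (Suc 0) f g"
      unfolding composable_1 using subsetD[OF Eq_stage_cell f(1)] subsetD[OF Eq_stage_cell g(1)]
        f(3) g(2) by simp
    then have "Dom X 0 (Comp X 0 1 f g) = a" "Cod X 0 (Comp X 0 1 f g) = c"
      using dom_comp[of 0 f g] cod_comp[of 0 f g] f(2) g(3) by (simp_all only: One_nat_def)
    with equiv_relI[OF FG] show "(a, c) \<in> equiv_rel X" by (simp only:)
  qed
qed

end

definition Pi0 :: "('a, 'm) omega_magma_scheme \<Rightarrow> 'a set set" where
  "Pi0 M = Cell M 0 // equiv_rel M"

text \<open>The map induced on classes.  If \<open>F\<close> does not respect the relations then some value of
  \<open>Pi0_map N F\<close> is a union of several classes of \<open>N\<close>, hence not a member of \<open>Pi0 N\<close>.\<close>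

definition Pi0_map :: "('b, 'n) omega_magma_scheme \<Rightarrow> (nat \<Rightarrow> 'a \<Rightarrow> 'b) \<Rightarrow> 'a set \<Rightarrow> 'b set" where
  "Pi0_map N F A = (\<Union>a\<in>A. equiv_rel N `` {F 0 a})"

definition tame ::
    "('a1, 'a2, 'a3) weak_omega_category \<Rightarrow> ('b1, 'b2, 'b3) weak_omega_category \<Rightarrow>
     (nat \<Rightarrow> 'a1 \<Rightarrow> 'b1) \<Rightarrow> bool" where
  "tame X Y F1 \<longleftrightarrow> (\<forall>i. F1 i ` Eq_cells (mag1 X) i \<subseteq> Eq_cells (mag1 Y) i)"

definition weak_equivalence ::
    "('a1, 'a2, 'a3) weak_omega_category \<Rightarrow> ('b1, 'b2, 'b3) weak_omega_category \<Rightarrow>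
     (nat \<Rightarrow> 'a1 \<Rightarrow> 'b1) \<Rightarrow> (nat \<Rightarrow> 'a2 \<Rightarrow> 'b2) \<Rightarrow> (nat \<Rightarrow> 'a3 \<Rightarrow> 'b3) \<Rightarrow> bool" where
  "weak_equivalence X Y F1 F2 F3 \<longleftrightarrow>
     omega_pseudo_functor X Y F1 F2 F3 \<and> tame X Y F1 \<and>
     bij_betw (Pi0_map (mag1 Y) F1) (Pi0 (mag1 X)) (Pi0 (mag1 Y)) \<and>
     (\<forall>n. \<forall>a\<in>Cell (mag1 X) n. \<forall>b\<in>Cell (mag1 X) n.
        bij_betw
          (Pi0_map (hom_magma (mag1 Y) n (F1 n a) (F1 n b)) (\<lambda>j. F1 (Suc n + j)))
          (Pi0 (hom_magma (mag1 X) n a b))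
          (Pi0 (hom_magma (mag1 Y) n (F1 n a) (F1 n b))))"


section \<open>Ordinary categories and their equivalences\<close>

text \<open>Composition \<open>Seq C f g\<close> is again diagrammatic.\<close>

record ('o, 'a) category =
  Obj :: "'o set"
  Arr :: "'a set"
  Src :: "'a \<Rightarrow> 'o"
  Tgt :: "'a \<Rightarrow> 'o"
  One :: "'o \<Rightarrow> 'a"
  Seq :: "'a \<Rightarrow> 'a \<Rightarrow> 'a"

locale category =
  fixes C :: "('o, 'a) category"
  assumes src_obj: "f \<in> Arr C \<Longrightarrow> Src C f \<in> Obj C"
    and tgt_obj: "f \<in> Arr C \<Longrightarrow> Tgt C f \<in> Obj C"
    and one_arr: "x \<in> Obj C \<Longrightarrow> One C x \<in> Arr C \<and> Src C (One C x) = x \<and> Tgt C (One C x) = x"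
    and seq_arr: "f \<in> Arr C \<Longrightarrow> g \<in> Arr C \<Longrightarrow> Tgt C f = Src C g \<Longrightarrow>
      Seq C f g \<in> Arr C \<and> Src C (Seq C f g) = Src C f \<and> Tgt C (Seq C f g) = Tgt C g"
    and one_seq: "f \<in> Arr C \<Longrightarrow> Seq C (One C (Src C f)) f = f"
    and seq_one: "f \<in> Arr C \<Longrightarrow> Seq C f (One C (Tgt C f)) = f"
    and seq_assoc: "f \<in> Arr C \<Longrightarrow> g \<in> Arr C \<Longrightarrow> h \<in> Arr C \<Longrightarrow>
      Tgt C f = Src C g \<Longrightarrow> Tgt C g = Src C h \<Longrightarrow>
      Seq C (Seq C f g) h = Seq C f (Seq C g h)"

definition is_functor ::
    "('o, 'a) category \<Rightarrow> ('p, 'b) category \<Rightarrow> ('o \<Rightarrow> 'p) \<Rightarrow> ('a \<Rightarrow> 'b) \<Rightarrow> bool" where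
  "is_functor C D Fo Fa \<longleftrightarrow>
     (\<forall>x\<in>Obj C. Fo x \<in> Obj D \<and> Fa (One C x) = One D (Fo x)) \<and>
     (\<forall>f\<in>Arr C. Fa f \<in> Arr D \<and> Src D (Fa f) = Fo (Src C f) \<and> Tgt D (Fa f) = Fo (Tgt C f)) \<and>
     (\<forall>f\<in>Arr C. \<forall>g\<in>Arr C. Tgt C f = Src C g \<longrightarrow> Fa (Seq C f g) = Seq D (Fa f) (Fa g))"

definition iso_arr :: "('o, 'a) category \<Rightarrow> 'a \<Rightarrow> bool" where
  "iso_arr C f \<longleftrightarrow> f \<in> Arr C \<and> (\<exists>g\<in>Arr C. Src C g = Tgt C f \<and> Tgt C g = Src C f \<and>
     Seq C f g = One C (Src C f) \<and> Seq C g f = One C (Tgt C f))"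

definition natural_iso ::
    "('o, 'a) category \<Rightarrow> ('p, 'b) category \<Rightarrow> ('o \<Rightarrow> 'p) \<Rightarrow> ('a \<Rightarrow> 'b) \<Rightarrow>
     ('o \<Rightarrow> 'p) \<Rightarrow> ('a \<Rightarrow> 'b) \<Rightarrow> ('o \<Rightarrow> 'b) \<Rightarrow> bool" where
  "natural_iso C D Fo Fa Go Ga \<eta> \<longleftrightarrow>
     (\<forall>x\<in>Obj C. iso_arr D (\<eta> x) \<and> Src D (\<eta> x) = Fo x \<and> Tgt D (\<eta> x) = Go x) \<and>
     (\<forall>f\<in>Arr C. Seq D (Fa f) (\<eta> (Tgt C f)) = Seq D (\<eta> (Src C f)) (Ga f))"

definition category_equivalence ::
    "('o, 'a) category \<Rightarrow> ('p, 'b) category \<Rightarrow> ('o \<Rightarrow> 'p) \<Rightarrow> ('a \<Rightarrow> 'b) \<Rightarrow> bool" where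
  "category_equivalence C D Fo Fa \<longleftrightarrow>
     category C \<and> category D \<and> is_functor C D Fo Fa \<and>
     (\<exists>Go Ga. is_functor D C Go Ga \<and>
        (\<exists>\<eta>. natural_iso C C (\<lambda>x. x) (\<lambda>f. f) (Go \<circ> Fo) (Ga \<circ> Fa) \<eta>) \<and>
        (\<exists>\<epsilon>. natural_iso D D (Fo \<circ> Go) (Fa \<circ> Ga) (\<lambda>x. x) (\<lambda>f. f) \<epsilon>))"

definition ordinary_category :: "('a, 'm) omega_magma_scheme \<Rightarrow> ('a, 'a) category" where
  "ordinary_category M =
     \<lparr>Obj = Cell M 0, Arr = Cell M 1, Src = Dom M 0, Tgt = Cod M 0, One = Idn M 0,
      Seq = Comp M 0 1\<rparr>"

end

theory Submission
  imports Defs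
begin

text \<open>
  In a \<open>1\<close>-skeletal omega magma every \<open>2\<close>-cell is an identity, so a \<open>2\<close>-cell from \<open>f\<close> to \<open>g\<close> is
  a proof that \<open>f = g\<close> (\<open>skeletal_boundary\<close>).  Everything follows by producing \<open>2\<close>-cells.

  They come from bridges.  If two parallel \<open>1\<close>-cells of the second magma of a weak omega category
  have the same image under \<open>kap\<close>, there is a bridge between them, \<open>lam\<close> sends it to a \<open>2\<close>-cell of
  the underlying magma, and so \<open>lam\<close> identifies the two \<open>1\<close>-cells (\<open>lam_eqI\<close>).  Every \<open>1\<close>-cell
  of the underlying magma is \<open>lam\<close> of its image under \<open>rho\<close>, so an equation between composites can
  be lifted to the second magma and tested there after \<open>kap\<close>, that is, in a strict omega category.
  This gives the category laws (\<open>weak_omega_category.ordinary_category\<close>).  It also gives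
  functoriality of \<open>F1\<close> (\<open>pseudo_functor_is_functor\<close>): a pseudo-functor preserves composites
  and identities only after \<open>kap\<close>, and that is what the test asks for.

  Since \<open>2\<close>-cells are identities, two \<open>1\<close>-cells of a hom magma are equivalent only if they
  are equal.  The bijections of classes of \<open>1\<close>-cells thus say that \<open>F1\<close> is fully faithful
  (\<open>Pi0_hom_skeletal\<close>).  The \<open>1\<close>-cells that are internal equivalences are isomorphisms
  (\<open>Eq_cells_1_iso\<close>): their composites with their inverses are related to identities by \<open>2\<close>-cells.
  Surjectivity on classes of \<open>0\<close>-cells thus says that \<open>F1\<close> is essentially surjective, and a fully
  faithful, essentially surjective functor is an equivalence (\<open>category_equivalenceI\<close>).
\<close>

section \<open>Fully faithful, essentially surjective functors\<close>

definition arrows :: "('o, 'a) category \<Rightarrow> 'o \<Rightarrow> 'o \<Rightarrow> 'a set" where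
  "arrows C x y = {f \<in> Arr C. Src C f = x \<and> Tgt C f = y}"

context category
begin

lemma arrows_obj: "f \<in> arrows C x y \<Longrightarrow> x \<in> Obj C \<and> y \<in> Obj C"
  unfolding arrows_def using src_obj tgt_obj by blast

lemma one_arrows: "x \<in> Obj C \<Longrightarrow> One C x \<in> arrows C x x"
  unfolding arrows_def using one_arr by blast

lemma seq_arrows: "f \<in> arrows C x y \<Longrightarrow> g \<in> arrows C y z \<Longrightarrow> Seq C f g \<in> arrows C x z"
  unfolding arrows_def using seq_arr by simp

lemma one_seq_arrows: "f \<in> arrows C x y \<Longrightarrow> Seq C (One C x) f = f"
  unfolding arrows_def using one_seq by blast

lemma seq_one_arrows: "f \<in> arrows C x y \<Longrightarrow> Seq C f (One C y) = f"
  unfolding arrows_def using seq_one by blast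

lemma seq_assoc_arrows:
  "f \<in> arrows C w x \<Longrightarrow> g \<in> arrows C x y \<Longrightarrow> h \<in> arrows C y z \<Longrightarrow>
    Seq C (Seq C f g) h = Seq C f (Seq C g h)"
  unfolding arrows_def using seq_assoc by simp

lemma seq_cancel_middle:
  assumes "f \<in> arrows C w x" "e \<in> arrows C x y" "e' \<in> arrows C y x" "g \<in> arrows C x z"
    and "Seq C e e' = One C x"
  shows "Seq C (Seq C f e) (Seq C e' g) = Seq C f g"
proof -
  have "Seq C (Seq C f e) (Seq C e' g) = Seq C f (Seq C e (Seq C e' g))"
    using assms seq_arrows seq_assoc_arrows by metis
  also have "Seq C e (Seq C e' g) = Seq C (Seq C e e') g"
    using assms seq_assoc_arrows by metis
  also have "\<dots> = g" using assms one_seq_arrows by metis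
  finally show ?thesis .
qed

lemma iso_arrI:
  assumes "f \<in> arrows C x y" "g \<in> arrows C y x" "Seq C f g = One C x" "Seq C g f = One C y"
  shows "iso_arr C f"
  using assms unfolding iso_arr_def arrows_def by auto

lemma iso_arrE:
  assumes "iso_arr C f" "Src C f = x" "Tgt C f = y"
  obtains g where "f \<in> arrows C x y" "g \<in> arrows C y x" "Seq C f g = One C x" "Seq C g f = One C y"
  using assms unfolding iso_arr_def arrows_def by auto

lemma iso_arr_one: "x \<in> Obj C \<Longrightarrow> iso_arr C (One C x)"
  using iso_arrI one_arrows one_seq_arrows by metis

lemma iso_arr_seq:
  assumes "iso_arr C f" "iso_arr C g" "Tgt C f = Src C g"
  shows "iso_arr C (Seq C f g)"
proof -
  obtain f' where f: "f \<in> arrows C (Src C f) (Src C g)" "f' \<in> arrows C (Src C g) (Src C f)"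
    "Seq C f f' = One C (Src C f)" "Seq C f' f = One C (Src C g)"
    using assms iso_arrE by metis
  obtain g' where g: "g \<in> arrows C (Src C g) (Tgt C g)" "g' \<in> arrows C (Tgt C g) (Src C g)"
    "Seq C g g' = One C (Src C g)" "Seq C g' g = One C (Tgt C g)"
    using assms iso_arrE by metis
  show ?thesis
  proof (rule iso_arrI)
    show "Seq C f g \<in> arrows C (Src C f) (Tgt C g)" "Seq C g' f' \<in> arrows C (Tgt C g) (Src C f)"
      using f g seq_arrows by blast+
    show "Seq C (Seq C f g) (Seq C g' f') = One C (Src C f)"
      using seq_cancel_middle[OF f(1) g(1,2) f(2) g(3)] f(3) by simp
    show "Seq C (Seq C g' f') (Seq C f g) = One C (Tgt C g)"
      using seq_cancel_middle[OF g(2) f(2,1) g(1) f(4)] g(4) by simp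
  qed
qed

end

text \<open>
  The quasi-inverse sends \<open>y\<close> to a chosen object whose image is isomorphic to \<open>y\<close> by a chosen
  \<open>e y\<close>, and sends an arrow to the unique arrow that lies over its conjugate by these isomorphisms.
  Every equation required in the source category is checked after applying \<open>Fa\<close>, which is
  faithful.
\<close>
theorem category_equivalenceI:
  assumes "category C" and "category D" and F: "is_functor C D Fo Fa"
    and ff: "\<And>x y. x \<in> Obj C \<Longrightarrow> y \<in> Obj C \<Longrightarrow>
      bij_betw Fa (arrows C x y) (arrows D (Fo x) (Fo y))"
    and es: "\<And>y. y \<in> Obj D \<Longrightarrow> \<exists>x\<in>Obj C. \<exists>e. iso_arr D e \<and> Src D e = Fo x \<and> Tgt D e = y"
  shows "category_equivalence C D Fo Fa"
proof -
  interpret C: category C by fact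
  interpret D: category D by fact
  have F_obj: "Fo x \<in> Obj D" "Fa (One C x) = One D (Fo x)" if "x \<in> Obj C" for x
    using F that unfolding is_functor_def by blast+
  have F_arrows: "Fa f \<in> arrows D (Fo x) (Fo y)" if "f \<in> arrows C x y" for f x y
    using F that unfolding is_functor_def arrows_def by blast
  have F_seq: "Fa (Seq C f g) = Seq D (Fa f) (Fa g)"
    if "f \<in> arrows C x y" "g \<in> arrows C y z" for f g x y z
    using F that unfolding is_functor_def arrows_def by simp
  have faithful: "f = g" if "f \<in> arrows C x y" "g \<in> arrows C x y" "Fa f = Fa g" for f g x y
    using bij_betw_imp_inj_on[OF ff] C.arrows_obj that by (metis inj_onD)
  have full: "\<exists>f. f \<in> arrows C x y \<and> Fa f = g"
    if "x \<in> Obj C" "y \<in> Obj C" "g \<in> arrows D (Fo x) (Fo y)" for x y g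
    using bij_betw_imp_surj_on[OF ff] that by (metis imageE)
  have "\<forall>y\<in>Obj D. \<exists>x e e'. x \<in> Obj C \<and> e \<in> arrows D (Fo x) y \<and> e' \<in> arrows D y (Fo x) \<and>
      Seq D e e' = One D (Fo x) \<and> Seq D e' e = One D y"
    using es D.iso_arrE by metis
  then obtain Go e e' where G_obj: "\<And>y. y \<in> Obj D \<Longrightarrow> Go y \<in> Obj C"
    and e: "\<And>y. y \<in> Obj D \<Longrightarrow> e y \<in> arrows D (Fo (Go y)) y"
    and e': "\<And>y. y \<in> Obj D \<Longrightarrow> e' y \<in> arrows D y (Fo (Go y))"
    and ee': "\<And>y. y \<in> Obj D \<Longrightarrow> Seq D (e y) (e' y) = One D (Fo (Go y))"
    and e'e: "\<And>y. y \<in> Obj D \<Longrightarrow> Seq D (e' y) (e y) = One D y"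
    by metis
  \<comment> \<open>The effect of the quasi-inverse on \<open>g\<close>, as seen in \<open>D\<close>.\<close>
  let ?conj = "\<lambda>g. Seq D (Seq D (e (Src D g)) g) (e' (Tgt D g))"
  have conj_arrows: "?conj g \<in> arrows D (Fo (Go (Src D g))) (Fo (Go (Tgt D g)))"
    and conj_obj: "Src D g \<in> Obj D" "Tgt D g \<in> Obj D"
    and self: "g \<in> arrows D (Src D g) (Tgt D g)" if "g \<in> Arr D" for g
  proof -
    show st: "Src D g \<in> Obj D" "Tgt D g \<in> Obj D" and g: "g \<in> arrows D (Src D g) (Tgt D g)"
      using that D.src_obj D.tgt_obj by (auto simp: arrows_def)
    show "?conj g \<in> arrows D (Fo (Go (Src D g))) (Fo (Go (Tgt D g)))"
      using D.seq_arrows[OF D.seq_arrows[OF e[OF st(1)] g] e'[OF st(2)]] .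
  qed
  have "\<forall>g\<in>Arr D. \<exists>f. f \<in> arrows C (Go (Src D g)) (Go (Tgt D g)) \<and> Fa f = ?conj g"
    using full conj_arrows conj_obj G_obj by simp
  then obtain Ga where Ga0: "\<And>g. g \<in> Arr D \<Longrightarrow> Ga g \<in> arrows C (Go (Src D g)) (Go (Tgt D g))"
    and FGa0: "\<And>g. g \<in> Arr D \<Longrightarrow> Fa (Ga g) = ?conj g"
    by metis
  have Ga: "Ga g \<in> arrows C (Go y) (Go z)"
    and FGa: "Fa (Ga g) = Seq D (Seq D (e y) g) (e' z)" if "g \<in> arrows D y z" for g y z
    using Ga0[of g] FGa0[of g] that by (simp_all add: arrows_def)
  have FGa_e: "Seq D (Fa (Ga g)) (e z) = Seq D (e y) g" if g: "g \<in> arrows D y z" for g y z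
  proof -
    have o: "y \<in> Obj D" "z \<in> Obj D" using D.arrows_obj[OF g] by auto
    have "Seq D (Seq D (Seq D (e y) g) (e' z)) (e z) = Seq D (Seq D (e y) g) (Seq D (e' z) (e z))"
      by (rule D.seq_assoc_arrows[OF D.seq_arrows[OF e[OF o(1)] g] e'[OF o(2)] e[OF o(2)]])
    then show ?thesis
      using FGa[OF g] e'e[OF o(2)] D.seq_one_arrows[OF D.seq_arrows[OF e[OF o(1)] g]] by simp
  qed
  have G: "is_functor D C Go Ga"
    unfolding is_functor_def
  proof (intro conjI ballI impI)
    fix y assume y: "y \<in> Obj D"
    show "Go y \<in> Obj C" using G_obj[OF y] .
    have one: "One D y \<in> arrows D y y" using D.one_arrows[OF y] .
    show "Ga (One D y) = One C (Go y)"
    proof (rule faithful[OF Ga[OF one] C.one_arrows[OF G_obj[OF y]]])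
      show "Fa (Ga (One D y)) = Fa (One C (Go y))"
        using FGa[OF one] D.seq_one_arrows[OF e[OF y]] ee'[OF y] F_obj(2)[OF G_obj[OF y]] by simp
    qed
  next
    fix f assume "f \<in> Arr D"
    from Ga0[OF this] show "Ga f \<in> Arr C" "Src C (Ga f) = Go (Src D f)" "Tgt C (Ga f) = Go (Tgt D f)"
      by (auto simp: arrows_def)
  next
    fix f g assume "f \<in> Arr D" "g \<in> Arr D" "Tgt D f = Src D g"
    then obtain w x y where f: "f \<in> arrows D w x" and g: "g \<in> arrows D x y"
      by (auto simp: arrows_def)
    have o: "w \<in> Obj D" "x \<in> Obj D" "y \<in> Obj D" using D.arrows_obj f g by blast+
    note fg = D.seq_arrows[OF f g]
    show "Ga (Seq D f g) = Seq C (Ga f) (Ga g)"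
    proof (rule faithful[OF Ga[OF fg] C.seq_arrows[OF Ga[OF f] Ga[OF g]]])
      have "Fa (Seq C (Ga f) (Ga g)) =
          Seq D (Seq D (Seq D (e w) f) (e' x)) (Seq D (Seq D (e x) g) (e' y))"
        using F_seq[OF Ga[OF f] Ga[OF g]] FGa f g by simp
      also have "Seq D (Seq D (e x) g) (e' y) = Seq D (e x) (Seq D g (e' y))"
        by (rule D.seq_assoc_arrows[OF e[OF o(2)] g e'[OF o(3)]])
      also have "Seq D (Seq D (Seq D (e w) f) (e' x)) (Seq D (e x) (Seq D g (e' y))) =
          Seq D (Seq D (e w) f) (Seq D g (e' y))"
        by (rule D.seq_cancel_middle[OF D.seq_arrows[OF e[OF o(1)] f] e'[OF o(2)] e[OF o(2)]
              D.seq_arrows[OF g e'[OF o(3)]] e'e[OF o(2)]])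
      also have "\<dots> = Seq D (Seq D (Seq D (e w) f) g) (e' y)"
        by (rule D.seq_assoc_arrows[OF D.seq_arrows[OF e[OF o(1)] f] g e'[OF o(3)], symmetric])
      also have "Seq D (Seq D (e w) f) g = Seq D (e w) (Seq D f g)"
        by (rule D.seq_assoc_arrows[OF e[OF o(1)] f g])
      finally show "Fa (Ga (Seq D f g)) = Fa (Seq C (Ga f) (Ga g))" using FGa[OF fg] by simp
    qed
  qed
  \<comment> \<open>The unit at \<open>x\<close> is the lift of the inverse of the chosen isomorphism at \<open>Fo x\<close>; the counit
    is \<open>e\<close> itself.\<close>
  have "\<forall>x\<in>Obj C. \<exists>u. u \<in> arrows C x (Go (Fo x)) \<and> Fa u = e' (Fo x)"
    using full G_obj F_obj e' by simp
  then obtain \<eta> where \<eta>: "\<And>x. x \<in> Obj C \<Longrightarrow> \<eta> x \<in> arrows C x (Go (Fo x))"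
    and F\<eta>: "\<And>x. x \<in> Obj C \<Longrightarrow> Fa (\<eta> x) = e' (Fo x)"
    by metis
  have "natural_iso C C (\<lambda>x. x) (\<lambda>f. f) (Go \<circ> Fo) (Ga \<circ> Fa) \<eta>"
    unfolding natural_iso_def o_apply
  proof (intro conjI ballI)
    fix x assume x: "x \<in> Obj C"
    note Fx = F_obj(1)[OF x] and GFx = G_obj[OF F_obj(1)[OF x]]
    obtain v where v: "v \<in> arrows C (Go (Fo x)) x" "Fa v = e (Fo x)"
      using full[OF GFx x e[OF Fx]] by blast
    show "iso_arr C (\<eta> x)"
    proof (rule C.iso_arrI[OF \<eta>[OF x] v(1)])
      show "Seq C (\<eta> x) v = One C x"
        by (rule faithful[OF C.seq_arrows[OF \<eta>[OF x] v(1)] C.one_arrows[OF x]])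
          (simp add: F_seq[OF \<eta>[OF x] v(1)] F\<eta>[OF x] v(2) e'e[OF Fx] F_obj(2)[OF x])
      show "Seq C v (\<eta> x) = One C (Go (Fo x))"
        by (rule faithful[OF C.seq_arrows[OF v(1) \<eta>[OF x]] C.one_arrows[OF GFx]])
          (simp add: F_seq[OF v(1) \<eta>[OF x]] F\<eta>[OF x] v(2) ee'[OF Fx] F_obj(2)[OF GFx])
    qed
    show "Src C (\<eta> x) = x" "Tgt C (\<eta> x) = Go (Fo x)" using \<eta>[OF x] by (auto simp: arrows_def)
  next
    fix f assume "f \<in> Arr C"
    then have f: "f \<in> arrows C (Src C f) (Tgt C f)" (is "_ \<in> arrows C ?x ?y") by (simp add: arrows_def)
    have o: "?x \<in> Obj C" "?y \<in> Obj C" using C.arrows_obj[OF f] by auto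
    note Fo = F_obj(1)[OF o(1)] F_obj(1)[OF o(2)] and Ff = F_arrows[OF f]
    show "Seq C f (\<eta> ?y) = Seq C (\<eta> ?x) (Ga (Fa f))"
    proof (rule faithful[OF C.seq_arrows[OF f \<eta>[OF o(2)]] C.seq_arrows[OF \<eta>[OF o(1)] Ga[OF Ff]]])
      have "Fa (Seq C (\<eta> ?x) (Ga (Fa f))) =
          Seq D (e' (Fo ?x)) (Seq D (Seq D (e (Fo ?x)) (Fa f)) (e' (Fo ?y)))"
        using F_seq[OF \<eta>[OF o(1)] Ga[OF Ff]] F\<eta>[OF o(1)] FGa[OF Ff] by simp
      also have "Seq D (Seq D (e (Fo ?x)) (Fa f)) (e' (Fo ?y)) =
          Seq D (e (Fo ?x)) (Seq D (Fa f) (e' (Fo ?y)))"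
        by (rule D.seq_assoc_arrows[OF e[OF Fo(1)] Ff e'[OF Fo(2)]])
      also have "Seq D (e' (Fo ?x)) \<dots> =
          Seq D (Seq D (e' (Fo ?x)) (e (Fo ?x))) (Seq D (Fa f) (e' (Fo ?y)))"
        by (rule D.seq_assoc_arrows[OF e'[OF Fo(1)] e[OF Fo(1)] D.seq_arrows[OF Ff e'[OF Fo(2)]],
              symmetric])
      also have "\<dots> = Seq D (Fa f) (e' (Fo ?y))"
        unfolding e'e[OF Fo(1)] by (rule D.one_seq_arrows[OF D.seq_arrows[OF Ff e'[OF Fo(2)]]])
      finally show "Fa (Seq C f (\<eta> ?y)) = Fa (Seq C (\<eta> ?x) (Ga (Fa f)))"
        using F_seq[OF f \<eta>[OF o(2)]] F\<eta>[OF o(2)] by simp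
    qed
  qed
  moreover have "natural_iso D D (Fo \<circ> Go) (Fa \<circ> Ga) (\<lambda>x. x) (\<lambda>f. f) e"
    unfolding natural_iso_def o_apply
  proof (intro conjI ballI)
    fix y assume y: "y \<in> Obj D"
    show "iso_arr D (e y)" by (rule D.iso_arrI[OF e[OF y] e'[OF y] ee'[OF y] e'e[OF y]])
    show "Src D (e y) = Fo (Go y)" "Tgt D (e y) = y" using e[OF y] by (auto simp: arrows_def)
  next
    fix g assume "g \<in> Arr D"
    from FGa_e[OF self[OF this]]
    show "Seq D (Fa (Ga g)) (e (Tgt D g)) = Seq D (e (Src D g)) g" .
  qed
  ultimately show ?thesis
    using assms(1,2) F G unfolding category_equivalence_def by blast
qed

section \<open>One-skeletal omega magmas\<close>

lemma ordinary_category_simps [simp]: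
  "Obj (ordinary_category M) = Cell M 0" "Arr (ordinary_category M) = Cell M 1"
  "Src (ordinary_category M) = Dom M 0" "Tgt (ordinary_category M) = Cod M 0"
  "One (ordinary_category M) = Idn M 0" "Seq (ordinary_category M) = Comp M 0 1"
  by (simp_all add: ordinary_category_def)

lemma (in omega_graph) skeletal_boundary:
  assumes "skeletal n X" "n \<le> k" "h \<in> Cell X (Suc k)"
  shows "Dom X k h = Cod X k h"
  using assms dom_id cod_id unfolding skeletal_def by fastforce

context omega_magma
begin

lemma comp_1:
  assumes "f \<in> Cell X 1" "g \<in> Cell X 1" "Cod X 0 f = Dom X 0 g"
  shows "Comp X 0 1 f g \<in> Cell X 1"
    "Dom X 0 (Comp X 0 1 f g) = Dom X 0 f" "Cod X 0 (Comp X 0 1 f g) = Cod X 0 g"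
proof -
  have c: "composable X 0 (Suc 0) f g" using assms by (simp add: composable_1)
  show "Comp X 0 1 f g \<in> Cell X 1"
    "Dom X 0 (Comp X 0 1 f g) = Dom X 0 f" "Cod X 0 (Comp X 0 1 f g) = Cod X 0 g"
    using comp_cell[OF c] dom_comp[OF c] cod_comp[OF c] by simp_all
qed

lemma id_1:
  assumes "x \<in> Cell X 0"
  shows "Idn X 0 x \<in> Cell X 1" "Dom X 0 (Idn X 0 x) = x" "Cod X 0 (Idn X 0 x) = x"
  using assms id_cell[of x 0] dom_id cod_id by simp_all

lemma equiv_rel_hom_skeletal:
  assumes "skeletal 1 X"
  shows "equiv_rel (hom_magma X 0 a b) = Id_on (Cell (hom_magma X 0 a b) 0)"
proof -
  let ?H = "hom_magma X 0 a b"
  interpret H: omega_magma ?H by (rule omega_magma_hom)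
  show ?thesis
  proof (rule set_eqI, clarify)
    fix f g
    show "(f, g) \<in> equiv_rel ?H \<longleftrightarrow> (f, g) \<in> Id_on (Cell ?H 0)"
    proof
      assume fg: "(f, g) \<in> equiv_rel ?H"
      then obtain n h where h: "h \<in> Eq_stage ?H n 1" "Dom ?H 0 h = f" "Cod ?H 0 h = g"
        by (rule H.equiv_relE)
      have "h \<in> Cell X (Suc 1)" using subsetD[OF H.Eq_stage_cell h(1)] by simp
      from skeletal_boundary[OF assms _ this] have "f = g" using h(2,3) by simp
      then show "(f, g) \<in> Id_on (Cell ?H 0)" using fg unfolding equiv_rel_def by blast
    next
      assume "(f, g) \<in> Id_on (Cell ?H 0)"
      then show "(f, g) \<in> equiv_rel ?H"
        using H.equiv_equiv_rel unfolding equiv_def refl_on_def by blast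
    qed
  qed
qed

lemma hom_0_arrows: "Cell (hom_magma X 0 a b) 0 = arrows (ordinary_category X) a b"
  by (auto simp: arrows_def)

text \<open>The classes are singletons, because \<open>1\<close>-cells of a hom magma are \<open>2\<close>-cells of \<open>X\<close>.\<close>
lemma Pi0_hom_skeletal:
  assumes "skeletal 1 X"
  shows "Pi0 (hom_magma X 0 a b) = (\<lambda>f. {f}) ` arrows (ordinary_category X) a b"
  unfolding Pi0_def equiv_rel_hom_skeletal[OF assms] hom_0_arrows quotient_def Id_on_def by auto


text \<open>
  In the free clique the round trip \<open>u \<circ> v\<close> is parallel to the identity, so a bridge \<open>2\<close>-cell joins
  them.  Its image in a \<open>1\<close>-skeletal magma is an identity and turns the two boundaries into one
  cell.
\<close>
lemma magma_morphism_Cl2_bridges_inverse: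
  assumes sk: "skeletal 1 X" and H: "magma_morphism Cl2 X H"
    and pq: "p \<in> {1, 2}" "q \<in> {1, 2}" "p \<noteq> q"
  defines "u \<equiv> BridgeT (PointT p) (PointT q)" and "v \<equiv> BridgeT (PointT q) (PointT p)"
  shows "H 1 u \<in> arrows (ordinary_category X) (H 0 (PointT p)) (H 0 (PointT q))"
    and "Comp X 0 1 (H 1 u) (H 1 v) = Idn X 0 (H 0 (PointT p))"
proof -
  have H_cell: "\<And>i x. x \<in> Cell Cl2 i \<Longrightarrow> H i x \<in> Cell X i"
    and H_dom: "\<And>i x. x \<in> Cell Cl2 (Suc i) \<Longrightarrow> H i (Dom Cl2 i x) = Dom X i (H (Suc i) x)"
    and H_cod: "\<And>i x. x \<in> Cell Cl2 (Suc i) \<Longrightarrow> H i (Cod Cl2 i x) = Cod X i (H (Suc i) x)"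
    and H_id: "\<And>i x. x \<in> Cell Cl2 i \<Longrightarrow> H (Suc i) (Idn Cl2 i x) = Idn X i (H i x)"
    and H_comp: "\<And>i j a b. composable Cl2 i j a b \<Longrightarrow>
      H j (Comp Cl2 i j a b) = Comp X i j (H j a) (H j b)"
    using H unfolding magma_morphism_def graph_morphism_def globular_morphism_def by blast+
  have "u \<in> Cell Cl2 (Suc 0)" using pq by (simp add: u_def)
  from H_cell[OF this] H_dom[OF this] H_cod[OF this]
  show "H 1 u \<in> arrows (ordinary_category X) (H 0 (PointT p)) (H 0 (PointT q))"
    by (simp add: arrows_def u_def)
  have "composable Cl2 0 1 u v" using pq by (simp add: composable_Cl2 u_def v_def)
  from H_comp[OF this] have uv: "H 1 (CompT 0 u v) = Comp X 0 1 (H 1 u) (H 1 v)" by simp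
  have id: "H 1 (IdT (PointT p)) = Idn X 0 (H 0 (PointT p))"
    using H_id[of "PointT p" 0] pq by simp
  let ?w = "BridgeT (CompT 0 u v) (IdT (PointT p))"
  have w: "?w \<in> Cell Cl2 (Suc 1)" using pq by (simp add: u_def v_def)
  have "Dom X 1 (H (Suc 1) ?w) = Cod X 1 (H (Suc 1) ?w)"
    using skeletal_boundary[OF sk _ H_cell[OF w]] by simp
  then have "H 1 (CompT 0 u v) = H 1 (IdT (PointT p))"
    using H_dom[OF w] H_cod[OF w] by simp
  then show "Comp X 0 1 (H 1 u) (H 1 v) = Idn X 0 (H 0 (PointT p))" unfolding uv id .
qed

text \<open>\<open>1\<close>-cells can be composed only along \<open>0\<close>-cells, and isomorphisms are closed under
  composition.\<close>
lemma composites_1_iso: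
  assumes "category (ordinary_category X)"
    and S: "\<And>f. f \<in> S 1 \<Longrightarrow> iso_arr (ordinary_category X) f"
    and "f \<in> composites X S 1"
  shows "iso_arr (ordinary_category X) f"
proof -
  interpret C: category "ordinary_category X" by fact
  have "j = 1 \<longrightarrow> iso_arr (ordinary_category X) f" if "(j, f) \<in> comp_closure X S" for j f
    using that
  proof (induction j f rule: comp_closure.induct)
    case (base x j)
    then show ?case using S by blast
  next
    case (comp j a b i)
    show ?case
    proof
      assume j: "j = 1"
      then have i: "i = 0" using comp.hyps by (auto simp: composable_def)
      have "composable X 0 (Suc 0) a b" using comp.hyps i j by simp
      then have "Cod X 0 a = Dom X 0 b" by (simp add: composable_1)
      moreover have "iso_arr (ordinary_category X) a" "iso_arr (ordinary_category X) b"
        using comp.IH j by auto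
      ultimately show "iso_arr (ordinary_category X) (Comp X i j a b)"
        using C.iso_arr_seq[of a b] unfolding i j by simp
    qed
  qed
  then show ?thesis using assms(3) unfolding composites_def by blast
qed

text \<open>
  At the first stage the generators are identities and images of bridges of the free clique.  At a
  later stage a new generator \<open>f\<close> comes with a candidate inverse \<open>g\<close> and with \<open>2\<close>-cells from
  \<open>f \<circ> g\<close> and \<open>g \<circ> f\<close> to identities.  Those
  \<open>2\<close>-cells are themselves identities, so \<open>g\<close> is a strict inverse.
\<close>
lemma Eq_cells_1_iso:
  assumes sk: "skeletal 1 X" and cat: "category (ordinary_category X)" and f: "f \<in> Eq_cells X 1"
  shows "iso_arr (ordinary_category X) f"
proof -
  let ?C = "ordinary_category X"
  interpret C: category ?C by (rule cat)
  have el: "iso_arr ?C g" if "g \<in> el X 1" for g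
  proof -
    from that consider a where "a \<in> Cell X 0" "g = Idn X 0 a"
      | H where "magma_morphism Cl2 X H" "H 1 (cl_c 1 2) = g"
      unfolding el_1 by blast
    then show ?thesis
    proof cases
      case 1
      then show ?thesis using C.iso_arr_one[of a] by simp
    next
      case (2 H)
      have g: "g = H 1 (BridgeT (PointT 1) (PointT 2))"
        using 2(2) by (simp add: cl_c_def cl_bridge_def)
      note inv12 = magma_morphism_Cl2_bridges_inverse[OF sk 2(1), of 1 2]
        and inv21 = magma_morphism_Cl2_bridges_inverse[OF sk 2(1), of 2 1]
      show ?thesis
        unfolding g using C.iso_arrI[OF inv12(1) inv21(1)] inv12(2) inv21(2) by simp
    qed
  qed
  have inv: "iso_arr ?C g" if g: "g \<in> inv_up_to X (Eq_stage X n) 1" for n g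
  proof -
    obtain k h h' where gk: "g \<in> Cell X 1" "k \<in> Cell X 1"
        "Dom X 0 k = Cod X 0 g" "Cod X 0 k = Dom X 0 g"
      and h: "h \<in> Eq_stage X n (Suc 1)" "h' \<in> Eq_stage X n (Suc 1)"
        "Dom X 1 h = Comp X 0 1 g k" "Cod X 1 h = Idn X 0 (Dom X 0 g)"
        "Dom X 1 h' = Comp X 0 1 k g" "Cod X 1 h' = Idn X 0 (Cod X 0 g)"
      using g unfolding One_nat_def inv_up_to.simps by blast
    have "Dom X 1 h = Cod X 1 h" "Dom X 1 h' = Cod X 1 h'"
      using skeletal_boundary[OF sk order.refl] subsetD[OF Eq_stage_cell] h(1,2) by blast+
    then show ?thesis using gk h unfolding iso_arr_def by auto
  qed
  have "\<forall>g\<in>Eq_stage X n 1. iso_arr ?C g" for n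
  proof (induction n)
    case 0
    show ?case using composites_1_iso[OF cat, of "el X"] el by simp
  next
    case (Suc n)
    have "iso_arr ?C g" if "g \<in> Eq_stage X n 1 \<union> inv_up_to X (Eq_stage X n) 1" for g
      using that Suc inv by blast
    from composites_1_iso[OF cat, of "\<lambda>k. Eq_stage X n k \<union> inv_up_to X (Eq_stage X n) k", OF this]
    show ?case unfolding Eq_stage.simps by blast
  qed
  then show ?thesis using f unfolding Eq_cells_def by blast
qed

end

section \<open>One-skeletal weak omega categories\<close>

lemma globular_morphism_1:
  assumes "globular_morphism X Y F"
  shows "x \<in> Cell X 0 \<Longrightarrow> F 0 x \<in> Cell Y 0" and "f \<in> Cell X 1 \<Longrightarrow> F 1 f \<in> Cell Y 1"
    and "f \<in> Cell X 1 \<Longrightarrow> Dom Y 0 (F 1 f) = F 0 (Dom X 0 f)"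
    and "f \<in> Cell X 1 \<Longrightarrow> Cod Y 0 (F 1 f) = F 0 (Cod X 0 f)"
  using assms unfolding globular_morphism_def One_nat_def by simp_all

lemma graph_morphism_1:
  assumes "graph_morphism X Y F" "x \<in> Cell X 0"
  shows "F 1 (Idn X 0 x) = Idn Y 0 (F 0 x)"
  using assms unfolding graph_morphism_def One_nat_def by blast

lemma magma_morphism_1:
  assumes "magma_morphism X Y F" "f \<in> Cell X 1" "g \<in> Cell X 1" "Cod X 0 f = Dom X 0 g"
  shows "F 1 (Comp X 0 1 f g) = Comp Y 0 1 (F 1 f) (F 1 g)"
  using assms by (simp add: magma_morphism_def composable_def)

lemma (in strict_omega_category) category_laws_1:
  shows "f \<in> Cell X 1 \<Longrightarrow> Comp X 0 1 (Idn X 0 (Dom X 0 f)) f = f"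
    and "f \<in> Cell X 1 \<Longrightarrow> Comp X 0 1 f (Idn X 0 (Cod X 0 f)) = f"
    and "f \<in> Cell X 1 \<Longrightarrow> g \<in> Cell X 1 \<Longrightarrow> h \<in> Cell X 1 \<Longrightarrow>
      Cod X 0 f = Dom X 0 g \<Longrightarrow> Cod X 0 g = Dom X 0 h \<Longrightarrow>
      Comp X 0 1 (Comp X 0 1 f g) h = Comp X 0 1 f (Comp X 0 1 g h)"
proof -
  show "f \<in> Cell X 1 \<Longrightarrow> Comp X 0 1 (Idn X 0 (Dom X 0 f)) f = f"
    "f \<in> Cell X 1 \<Longrightarrow> Comp X 0 1 f (Idn X 0 (Cod X 0 f)) = f"
    using left_unit[of 0 1 f] right_unit[of 0 1 f] by simp_all
  assume "f \<in> Cell X 1" "g \<in> Cell X 1" "h \<in> Cell X 1"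
    "Cod X 0 f = Dom X 0 g" "Cod X 0 g = Dom X 0 h"
  with comp_1[of f g] comp_1[of g h] assoc[of 0 1 f g h]
  show "Comp X 0 1 (Comp X 0 1 f g) h = Comp X 0 1 f (Comp X 0 1 g h)"
    by (simp add: composable_1)
qed

context weak_omega_category
begin

sublocale M1: omega_magma "mag1 X" by (rule mag1)
sublocale M2: omega_magma "mag2 X" by (rule mag2)
sublocale M3: strict_omega_category "mag3 X" by (rule mag3)

lemma lam_graph: "graph_morphism (mag2 X) (mag1 X) (lam X)"
  using lam unfolding magma_morphism_def by blast

lemma lam_globular: "globular_morphism (mag2 X) (mag1 X) (lam X)"
  using lam_graph unfolding graph_morphism_def by blast

lemma rho_globular: "globular_morphism (mag1 X) (mag2 X) (rho X)"
  using rho unfolding graph_morphism_def by blast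

lemma kap_magma: "magma_morphism (mag2 X) (mag3 X) (kap X)"
  using kap unfolding categorical_Penon_morphism_def bridge_morphism_def by blast

lemma kap_graph: "graph_morphism (mag2 X) (mag3 X) (kap X)"
  using kap_magma unfolding magma_morphism_def by blast

lemma kap_globular: "globular_morphism (mag2 X) (mag3 X) (kap X)"
  using kap_graph unfolding graph_morphism_def by blast

text \<open>
  Equal images under \<open>kap\<close> give a bridge from \<open>x\<close> to \<open>y\<close>, and \<open>lam\<close> maps it to a \<open>2\<close>-cell from
  \<open>lam x\<close> to \<open>lam y\<close>, which can only be an identity.
\<close>
lemma lam_eqI:
  assumes sk: "skeletal 1 (mag1 X)"
    and x: "x \<in> Cell (mag2 X) 1" and y: "y \<in> Cell (mag2 X) 1"
    and "Dom (mag2 X) 0 x = Dom (mag2 X) 0 y" "Cod (mag2 X) 0 x = Cod (mag2 X) 0 y"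
    and "kap X 1 x = kap X 1 y"
  shows "lam X 1 x = lam X 1 y"
proof -
  have "parallel (mag2 X) 1 x y" using assms by simp
  then obtain c where c: "(x, y, c) \<in> brel X 1"
    using kap assms unfolding categorical_Penon_morphism_def by blast
  interpret bridge_relation "mag2 X" "brel X" by (rule brel)
  have cell: "c \<in> Cell (mag2 X) (Suc 1)"
    and bdry: "Dom (mag2 X) 1 c = x" "Cod (mag2 X) 1 c = y"
    using bridge_cells[OF c] bridge_boundary[OF c] by blast+
  have l: "lam X (Suc 1) c \<in> Cell (mag1 X) (Suc 1)"
    "lam X 1 (Dom (mag2 X) 1 c) = Dom (mag1 X) 1 (lam X (Suc 1) c)"
    "lam X 1 (Cod (mag2 X) 1 c) = Cod (mag1 X) 1 (lam X (Suc 1) c)"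
    using lam_globular cell unfolding globular_morphism_def by blast+
  show ?thesis using M1.skeletal_boundary[OF sk order.refl l(1)] l(2,3) bdry by simp
qed

text \<open>
  For each law both sides are lifted along \<open>rho\<close> to the second magma, where they are parallel but
  in general different; \<open>kap\<close> identifies them because the law holds in the third magma, and then
  so does \<open>lam\<close>.
\<close>
lemma ordinary_category:
  assumes sk: "skeletal 1 (mag1 X)"
  shows "category (ordinary_category (mag1 X))"
proof -
  note rho1 = globular_morphism_1[OF rho_globular] and kap1 = globular_morphism_1[OF kap_globular]
    and lam_comp = magma_morphism_1[OF lam] and kap_comp = magma_morphism_1[OF kap_magma]
    and lam_id = graph_morphism_1[OF lam_graph] and kap_id = graph_morphism_1[OF kap_graph]
  show ?thesis
  proof (unfold_locales, unfold ordinary_category_simps)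
    fix f assume f: "f \<in> Cell (mag1 X) 1"
    then show "Dom (mag1 X) 0 f \<in> Cell (mag1 X) 0" "Cod (mag1 X) 0 f \<in> Cell (mag1 X) 0"
      using M1.dom_cell[of f 0] M1.cod_cell[of f 0] by simp_all
    let ?r = "rho X 1 f"
    have r: "?r \<in> Cell (mag2 X) 1" using rho1(2) f .
    have D: "Dom (mag2 X) 0 ?r \<in> Cell (mag2 X) 0" "Cod (mag2 X) 0 ?r \<in> Cell (mag2 X) 0"
      using M2.dom_cell[of ?r 0] M2.cod_cell[of ?r 0] r by simp_all
    note idD = M2.id_1[OF D(1)] and idC = M2.id_1[OF D(2)]
    have l: "lam X 1 ?r = f" using lam_rho[OF f] .
    have lD: "lam X 0 (Dom (mag2 X) 0 ?r) = Dom (mag1 X) 0 f"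
      "lam X 0 (Cod (mag2 X) 0 ?r) = Cod (mag1 X) 0 f"
      using globular_morphism_1(3,4)[OF lam_globular r] l by simp_all
    have "lam X 1 (Comp (mag2 X) 0 1 (Idn (mag2 X) 0 (Dom (mag2 X) 0 ?r)) ?r) = lam X 1 ?r"
    proof (rule lam_eqI[OF sk _ r])
      note c = M2.comp_1[OF idD(1) r idD(3)]
      show "Comp (mag2 X) 0 1 (Idn (mag2 X) 0 (Dom (mag2 X) 0 ?r)) ?r \<in> Cell (mag2 X) 1"
        using c(1) .
      show "Dom (mag2 X) 0 (Comp (mag2 X) 0 1 (Idn (mag2 X) 0 (Dom (mag2 X) 0 ?r)) ?r)
          = Dom (mag2 X) 0 ?r"
        "Cod (mag2 X) 0 (Comp (mag2 X) 0 1 (Idn (mag2 X) 0 (Dom (mag2 X) 0 ?r)) ?r)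
          = Cod (mag2 X) 0 ?r"
        using c(2,3) idD(2) by simp_all
      show "kap X 1 (Comp (mag2 X) 0 1 (Idn (mag2 X) 0 (Dom (mag2 X) 0 ?r)) ?r) = kap X 1 ?r"
        unfolding kap_comp[OF idD(1) r idD(3)] kap_id[OF D(1)] kap1(3)[OF r, symmetric]
        by (rule M3.category_laws_1(1)[OF kap1(2)[OF r]])
    qed
    then show "Comp (mag1 X) 0 1 (Idn (mag1 X) 0 (Dom (mag1 X) 0 f)) f = f"
      unfolding lam_comp[OF idD(1) r idD(3)] lam_id[OF D(1)] lD l .
    have "lam X 1 (Comp (mag2 X) 0 1 ?r (Idn (mag2 X) 0 (Cod (mag2 X) 0 ?r))) = lam X 1 ?r"
    proof (rule lam_eqI[OF sk _ r])
      note c = M2.comp_1[OF r idC(1) idC(2)[symmetric]]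
      show "Comp (mag2 X) 0 1 ?r (Idn (mag2 X) 0 (Cod (mag2 X) 0 ?r)) \<in> Cell (mag2 X) 1"
        using c(1) .
      show "Dom (mag2 X) 0 (Comp (mag2 X) 0 1 ?r (Idn (mag2 X) 0 (Cod (mag2 X) 0 ?r)))
          = Dom (mag2 X) 0 ?r"
        "Cod (mag2 X) 0 (Comp (mag2 X) 0 1 ?r (Idn (mag2 X) 0 (Cod (mag2 X) 0 ?r)))
          = Cod (mag2 X) 0 ?r"
        using c(2,3) idC(3) by simp_all
      show "kap X 1 (Comp (mag2 X) 0 1 ?r (Idn (mag2 X) 0 (Cod (mag2 X) 0 ?r))) = kap X 1 ?r"
        unfolding kap_comp[OF r idC(1) idC(2)[symmetric]] kap_id[OF D(2)] kap1(4)[OF r, symmetric]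
        by (rule M3.category_laws_1(2)[OF kap1(2)[OF r]])
    qed
    then show "Comp (mag1 X) 0 1 f (Idn (mag1 X) 0 (Cod (mag1 X) 0 f)) = f"
      unfolding lam_comp[OF r idC(1) idC(2)[symmetric]] lam_id[OF D(2)] lD l .
  next
    fix x assume "x \<in> Cell (mag1 X) 0"
    from M1.id_1[OF this]
    show "Idn (mag1 X) 0 x \<in> Cell (mag1 X) 1 \<and> Dom (mag1 X) 0 (Idn (mag1 X) 0 x) = x \<and>
        Cod (mag1 X) 0 (Idn (mag1 X) 0 x) = x" by blast
  next
    fix f g assume "f \<in> Cell (mag1 X) 1" "g \<in> Cell (mag1 X) 1" "Cod (mag1 X) 0 f = Dom (mag1 X) 0 g"
    from M1.comp_1[OF this]
    show "Comp (mag1 X) 0 1 f g \<in> Cell (mag1 X) 1 \<and>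
        Dom (mag1 X) 0 (Comp (mag1 X) 0 1 f g) = Dom (mag1 X) 0 f \<and>
        Cod (mag1 X) 0 (Comp (mag1 X) 0 1 f g) = Cod (mag1 X) 0 g" by blast
  next
    fix f g h
    assume fgh: "f \<in> Cell (mag1 X) 1" "g \<in> Cell (mag1 X) 1" "h \<in> Cell (mag1 X) 1"
      and fg: "Cod (mag1 X) 0 f = Dom (mag1 X) 0 g" and gh: "Cod (mag1 X) 0 g = Dom (mag1 X) 0 h"
    let ?f = "rho X 1 f" and ?g = "rho X 1 g" and ?h = "rho X 1 h"
    let ?c = "Comp (mag2 X) 0 1"
    note r = rho1(2)[OF fgh(1)] rho1(2)[OF fgh(2)] rho1(2)[OF fgh(3)]
    have rfg: "Cod (mag2 X) 0 ?f = Dom (mag2 X) 0 ?g" and rgh: "Cod (mag2 X) 0 ?g = Dom (mag2 X) 0 ?h"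
      using rho1(3,4) fgh fg gh by simp_all
    note cfg = M2.comp_1[OF r(1,2) rfg] and cgh = M2.comp_1[OF r(2,3) rgh]
    have j: "Cod (mag2 X) 0 (?c ?f ?g) = Dom (mag2 X) 0 ?h"
      "Cod (mag2 X) 0 ?f = Dom (mag2 X) 0 (?c ?g ?h)"
      using cfg cgh rfg rgh by simp_all
    note l = M2.comp_1[OF cfg(1) r(3) j(1)] and m = M2.comp_1[OF r(1) cgh(1) j(2)]
    have "lam X 1 (?c (?c ?f ?g) ?h) = lam X 1 (?c ?f (?c ?g ?h))"
    proof (rule lam_eqI[OF sk l(1) m(1)])
      show "Dom (mag2 X) 0 (?c (?c ?f ?g) ?h) = Dom (mag2 X) 0 (?c ?f (?c ?g ?h))"
        "Cod (mag2 X) 0 (?c (?c ?f ?g) ?h) = Cod (mag2 X) 0 (?c ?f (?c ?g ?h))"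
        using l m cfg cgh by simp_all
      have "Cod (mag3 X) 0 (kap X 1 ?f) = Dom (mag3 X) 0 (kap X 1 ?g)"
        "Cod (mag3 X) 0 (kap X 1 ?g) = Dom (mag3 X) 0 (kap X 1 ?h)"
        using kap1(3,4) r rfg rgh by simp_all
      from M3.category_laws_1(3)[OF kap1(2)[OF r(1)] kap1(2)[OF r(2)] kap1(2)[OF r(3)] this]
      show "kap X 1 (?c (?c ?f ?g) ?h) = kap X 1 (?c ?f (?c ?g ?h))"
        unfolding kap_comp[OF cfg(1) r(3) j(1)] kap_comp[OF r(1) cgh(1) j(2)]
          kap_comp[OF r(1,2) rfg] kap_comp[OF r(2,3) rgh] .
    qed
    then show "Comp (mag1 X) 0 1 (Comp (mag1 X) 0 1 f g) h = Comp (mag1 X) 0 1 f (Comp (mag1 X) 0 1 g h)"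
      unfolding lam_comp[OF cfg(1) r(3) j(1)] lam_comp[OF r(1) cgh(1) j(2)]
        lam_comp[OF r(1,2) rfg] lam_comp[OF r(2,3) rgh]
        lam_rho[OF fgh(1)] lam_rho[OF fgh(2)] lam_rho[OF fgh(3)] .
  qed
qed

end

section \<open>Weak equivalences between one-skeletal weak omega categories\<close>

text \<open>
  \<open>F1\<close> of a composite is \<open>lam\<close> of \<open>F2\<close> of the lifted composite.  \<open>F2\<close> need not preserve the
  composite, but both candidates have the same image under \<open>kap\<close>, by the condition on composites in
  the definition of a pseudo-functor.  For identities the images agree because \<open>F3\<close> and \<open>kap\<close>
  preserve identities.
\<close>
lemma pseudo_functor_is_functor:
  fixes X :: "('a1, 'a2, 'a3) weak_omega_category"
    and Y :: "('b1, 'b2, 'b3) weak_omega_category"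
  assumes "weak_omega_category X" and "weak_omega_category Y"
    and F: "omega_pseudo_functor X Y F1 F2 F3"
    and sk: "skeletal 1 (mag1 Y)"
  shows "is_functor (ordinary_category (mag1 X)) (ordinary_category (mag1 Y)) (F1 0) (F1 1)"
proof -
  interpret X: weak_omega_category X by fact
  interpret Y: weak_omega_category Y by fact
  have F1: "globular_morphism (mag1 X) (mag1 Y) F1" and F2: "globular_morphism (mag2 X) (mag2 Y) F2"
    and F3: "graph_morphism (mag3 X) (mag3 Y) F3"
    and F_lam: "\<And>i x. x \<in> Cell (mag2 X) i \<Longrightarrow> F1 i (lam X i x) = lam Y i (F2 i x)"
    and F_kap: "\<And>i x. x \<in> Cell (mag2 X) i \<Longrightarrow> F3 i (kap X i x) = kap Y i (F2 i x)"
    and F_comp: "\<And>i a b. composable (mag2 X) i (Suc i) a b \<Longrightarrow>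
      kap Y (Suc i) (Comp (mag2 Y) i (Suc i) (F2 (Suc i) a) (F2 (Suc i) b))
        = kap Y (Suc i) (F2 (Suc i) (Comp (mag2 X) i (Suc i) a b))"
    using F unfolding omega_pseudo_functor_def by blast+
  note F1_1 = globular_morphism_1[OF F1] and F2_1 = globular_morphism_1[OF F2]
    and rho1 = globular_morphism_1[OF X.rho_globular]
  show ?thesis
    unfolding is_functor_def ordinary_category_simps
  proof (intro conjI ballI impI)
    fix x assume x: "x \<in> Cell (mag1 X) 0"
    show "F1 0 x \<in> Cell (mag1 Y) 0" using F1_1(1)[OF x] .
    let ?r = "rho X 0 x"
    note r = rho1(1)[OF x]
    note Fr = F2_1(1)[OF r] and id = X.M2.id_1[OF r]
    note idF = Y.M2.id_1[OF Fr]
    have lFr: "lam Y 0 (F2 0 ?r) = F1 0 x" using F_lam[OF r] X.lam_rho[OF x] by simp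
    have "lam Y 1 (F2 1 (Idn (mag2 X) 0 ?r)) = lam Y 1 (Idn (mag2 Y) 0 (F2 0 ?r))"
    proof (rule Y.lam_eqI[OF sk F2_1(2)[OF id(1)] idF(1)])
      show "Dom (mag2 Y) 0 (F2 1 (Idn (mag2 X) 0 ?r)) = Dom (mag2 Y) 0 (Idn (mag2 Y) 0 (F2 0 ?r))"
        "Cod (mag2 Y) 0 (F2 1 (Idn (mag2 X) 0 ?r)) = Cod (mag2 Y) 0 (Idn (mag2 Y) 0 (F2 0 ?r))"
        unfolding F2_1(3,4)[OF id(1)] id(2,3) idF(2,3) by (rule refl)+
      have "kap X 0 ?r \<in> Cell (mag3 X) 0" using globular_morphism_1(1)[OF X.kap_globular r] .
      from graph_morphism_1[OF F3 this]
      show "kap Y 1 (F2 1 (Idn (mag2 X) 0 ?r)) = kap Y 1 (Idn (mag2 Y) 0 (F2 0 ?r))"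
        unfolding F_kap[OF id(1), symmetric] graph_morphism_1[OF X.kap_graph r]
          graph_morphism_1[OF Y.kap_graph Fr] F_kap[OF r] .
    qed
    then show "F1 1 (Idn (mag1 X) 0 x) = Idn (mag1 Y) 0 (F1 0 x)"
      unfolding F_lam[OF id(1), symmetric] graph_morphism_1[OF X.lam_graph r]
        graph_morphism_1[OF Y.lam_graph Fr] lFr X.lam_rho[OF x] .
  next
    fix f assume f: "f \<in> Cell (mag1 X) 1"
    show "F1 1 f \<in> Cell (mag1 Y) 1" "Dom (mag1 Y) 0 (F1 1 f) = F1 0 (Dom (mag1 X) 0 f)"
      "Cod (mag1 Y) 0 (F1 1 f) = F1 0 (Cod (mag1 X) 0 f)"
      using F1_1(2-4)[OF f] .
  next
    fix f g
    assume f: "f \<in> Cell (mag1 X) 1" and g: "g \<in> Cell (mag1 X) 1"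
      and fg: "Cod (mag1 X) 0 f = Dom (mag1 X) 0 g"
    let ?f = "rho X 1 f" and ?g = "rho X 1 g"
    note r = rho1(2)[OF f] rho1(2)[OF g]
    have rfg: "Cod (mag2 X) 0 ?f = Dom (mag2 X) 0 ?g" using rho1(3,4) f g fg by simp
    note c = X.M2.comp_1[OF r rfg] and Fr = F2_1(2)[OF r(1)] F2_1(2)[OF r(2)]
    have Frfg: "Cod (mag2 Y) 0 (F2 1 ?f) = Dom (mag2 Y) 0 (F2 1 ?g)" using F2_1(3,4) r rfg by simp
    note Fc = Y.M2.comp_1[OF Fr Frfg]
    have "lam Y 1 (F2 1 (Comp (mag2 X) 0 1 ?f ?g))
        = lam Y 1 (Comp (mag2 Y) 0 1 (F2 1 ?f) (F2 1 ?g))"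
    proof (rule Y.lam_eqI[OF sk F2_1(2)[OF c(1)] Fc(1)])
      show "Dom (mag2 Y) 0 (F2 1 (Comp (mag2 X) 0 1 ?f ?g))
          = Dom (mag2 Y) 0 (Comp (mag2 Y) 0 1 (F2 1 ?f) (F2 1 ?g))"
        "Cod (mag2 Y) 0 (F2 1 (Comp (mag2 X) 0 1 ?f ?g))
          = Cod (mag2 Y) 0 (Comp (mag2 Y) 0 1 (F2 1 ?f) (F2 1 ?g))"
        unfolding F2_1(3,4)[OF c(1)] c(2,3) Fc(2,3) F2_1(3)[OF r(1)] F2_1(4)[OF r(2)]
        by (rule refl)+
      have "composable (mag2 X) 0 (Suc 0) ?f ?g" using r rfg by (simp add: X.M2.composable_1)
      from F_comp[OF this]
      show "kap Y 1 (F2 1 (Comp (mag2 X) 0 1 ?f ?g))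
          = kap Y 1 (Comp (mag2 Y) 0 1 (F2 1 ?f) (F2 1 ?g))" by simp
    qed
    then show "F1 1 (Comp (mag1 X) 0 1 f g) = Comp (mag1 Y) 0 1 (F1 1 f) (F1 1 g)"
      unfolding F_lam[OF c(1), symmetric] magma_morphism_1[OF X.lam r rfg]
        magma_morphism_1[OF Y.lam Fr Frfg] F_lam[OF r(1), symmetric] F_lam[OF r(2), symmetric]
        X.lam_rho[OF f] X.lam_rho[OF g] .
  qed
qed

text \<open>
  The induced map sends a class \<open>A\<close> to the union of the classes of the \<open>F 0 x\<close> with \<open>x \<in> A\<close>.  If
  this union is the class of \<open>y\<close>, then it contains \<open>y\<close>, so \<open>y\<close> is equivalent to one of the
  \<open>F 0 x\<close>.
\<close>
lemma Pi0_map_surj_obtain: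
  assumes M: "omega_magma M" and N: "omega_magma N"
    and surj: "Pi0 N \<subseteq> Pi0_map N F ` Pi0 M" and y: "y \<in> Cell N 0"
  obtains x where "x \<in> Cell M 0" "(F 0 x, y) \<in> equiv_rel N"
proof -
  interpret M: omega_magma M by fact
  interpret N: omega_magma N by fact
  have "equiv_rel N `` {y} \<in> Pi0 N" using y unfolding Pi0_def by (rule quotientI)
  then obtain A where A: "A \<in> Pi0 M" "equiv_rel N `` {y} = Pi0_map N F A" using surj by blast
  have "y \<in> equiv_rel N `` {y}" using equiv_class_self[OF N.equiv_equiv_rel y] .
  then obtain x where "x \<in> A" "(F 0 x, y) \<in> equiv_rel N" unfolding A(2) Pi0_map_def by blast
  moreover have "A \<subseteq> Cell M 0"
    using in_quotient_imp_subset[OF M.equiv_equiv_rel] A(1) unfolding Pi0_def by blast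
  ultimately show thesis using that by blast
qed

lemma bij_betw_singletons:
  assumes "bij_betw P ((\<lambda>f. {f}) ` A) ((\<lambda>f. {f}) ` B)" and P: "\<And>f. f \<in> A \<Longrightarrow> P {f} = {G f}"
  shows "bij_betw G A B"
proof (rule bij_betw_imageI)
  show "inj_on G A"
  proof (rule inj_onI)
    fix f g assume fg: "f \<in> A" "g \<in> A" "G f = G g"
    then have "P {f} = P {g}" using P by simp
    then have "{f} = {g}" using bij_betw_imp_inj_on[OF assms(1)] fg(1,2) by (meson imageI inj_onD)
    then show "f = g" by simp
  qed
  have "(\<lambda>f. {f}) ` G ` A = P ` (\<lambda>f. {f}) ` A" using P by (simp add: image_image)
  also have "\<dots> = (\<lambda>f. {f}) ` B" using bij_betw_imp_surj_on[OF assms(1)] .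
  finally show "G ` A = B" by blast
qed

theorem theorem54:
  fixes X :: "('a1, 'a2, 'a3) weak_omega_category"
    and Y :: "('b1, 'b2, 'b3) weak_omega_category"
    and F1 :: "nat \<Rightarrow> 'a1 \<Rightarrow> 'b1" and F2 :: "nat \<Rightarrow> 'a2 \<Rightarrow> 'b2" and F3 :: "nat \<Rightarrow> 'a3 \<Rightarrow> 'b3"
  assumes "weak_omega_category X" and "weak_omega_category Y"
    and "omega_pseudo_functor X Y F1 F2 F3"
    and "weak_equivalence X Y F1 F2 F3"
    and "skeletal 1 (mag1 X)" and "skeletal 1 (mag1 Y)"
  shows "category_equivalence (ordinary_category (mag1 X)) (ordinary_category (mag1 Y))
           (F1 0) (F1 1)"
proof -
  interpret X: weak_omega_category X by fact
  interpret Y: weak_omega_category Y by fact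
  let ?C = "ordinary_category (mag1 X)" and ?D = "ordinary_category (mag1 Y)"
  have C: "category ?C" and D: "category ?D"
    using X.ordinary_category Y.ordinary_category assms(5,6) by blast+
  have F: "is_functor ?C ?D (F1 0) (F1 1)"
    by (rule pseudo_functor_is_functor[OF assms(1-3,6)])
  have bij_Pi0: "bij_betw (Pi0_map (mag1 Y) F1) (Pi0 (mag1 X)) (Pi0 (mag1 Y))"
    and bij_hom: "\<And>n a b. a \<in> Cell (mag1 X) n \<Longrightarrow> b \<in> Cell (mag1 X) n \<Longrightarrow>
      bij_betw (Pi0_map (hom_magma (mag1 Y) n (F1 n a) (F1 n b)) (\<lambda>j. F1 (Suc n + j)))
        (Pi0 (hom_magma (mag1 X) n a b)) (Pi0 (hom_magma (mag1 Y) n (F1 n a) (F1 n b)))"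
    using assms(4) unfolding weak_equivalence_def by blast+
  show ?thesis
  proof (rule category_equivalenceI[OF C D F])
    fix a b assume "a \<in> Obj ?C" "b \<in> Obj ?C"
    then have ab: "a \<in> Cell (mag1 X) 0" "b \<in> Cell (mag1 X) 0" by simp_all
    show "bij_betw (F1 1) (arrows ?C a b) (arrows ?D (F1 0 a) (F1 0 b))"
    proof (rule bij_betw_singletons)
      let ?P = "Pi0_map (hom_magma (mag1 Y) 0 (F1 0 a) (F1 0 b)) (\<lambda>j. F1 (Suc 0 + j))"
      show "bij_betw ?P ((\<lambda>f. {f}) ` arrows ?C a b) ((\<lambda>f. {f}) ` arrows ?D (F1 0 a) (F1 0 b))"
        using bij_hom[OF ab] unfolding X.M1.Pi0_hom_skeletal[OF assms(5)]
          Y.M1.Pi0_hom_skeletal[OF assms(6)] .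
      fix f assume "f \<in> arrows ?C a b"
      then have "F1 1 f \<in> arrows ?D (F1 0 a) (F1 0 b)"
        using F unfolding is_functor_def arrows_def by blast
      then show "?P {f} = {F1 1 f}"
        unfolding Pi0_map_def Y.M1.equiv_rel_hom_skeletal[OF assms(6)] Y.M1.hom_0_arrows by auto
    qed
  next
    fix y assume "y \<in> Obj ?D"
    then have "y \<in> Cell (mag1 Y) 0" by simp
    then obtain x where x: "x \<in> Cell (mag1 X) 0" "(F1 0 x, y) \<in> equiv_rel (mag1 Y)"
      using Pi0_map_surj_obtain[OF X.mag1 Y.mag1]
        equalityD2[OF bij_betw_imp_surj_on[OF bij_Pi0]] by metis
    then obtain e where "e \<in> Eq_cells (mag1 Y) 1" "Dom (mag1 Y) 0 e = F1 0 x" "Cod (mag1 Y) 0 e = y"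
      unfolding equiv_rel_def by blast
    then show "\<exists>x\<in>Obj ?C. \<exists>e. iso_arr ?D e \<and> Src ?D e = F1 0 x \<and> Tgt ?D e = y"
      using Y.M1.Eq_cells_1_iso[OF assms(6) D] x(1) unfolding ordinary_category_simps by blast
  qed
qed

end
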